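(* Let ${\cal S}$ be a finite set with cardinality $N$, let $P=(p(x,y))$ be an irreducible aperiodic transition matrix on ${\cal S}$ without loops ($p(x,x)=0$ for all $x$), with invariant probability distribution $\pi$. Then the cat and mouse Markov chain $(C_n,M_n)$ associated with $P$ converges in distribution to a random variable $(C_\infty,M_\infty)$ such that $$\mathbb{P}(C_\infty=x,M_\infty=y)=\alpha^{-1}\pi(x)\,\mathbb{E}_x\Bigl(\sum_{n=1}^{H_y^*}p(C_n^*,y)\Bigr),\qquad x,y\in{\cal S},$$ with $$\alpha=\sum_{y\in{\cal S}}\mathbb{E}_\pi\bigl(p(C_0,y)H_y\bigr);$$ in particular $\mathbb{P}(C_\infty=M_\infty=x)=\alpha^{-1}\pi(x)$ for $x\in{\cal S}$. If the Markov chain $(C_n)$ is reversible, then $$\mathbb{P}(M_\infty=y)=\frac{1-\pi(y)}{N-1},\qquad y\in{\cal S}.$$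
   Context: The cat and mouse Markov chain $(C_n,M_n)$ associated with $P$ is the Markov chain on ${\cal S}\times{\cal S}$ with transition matrix $Q=(q(\cdot,\cdot))$ given, for $x,y,z,w\in{\cal S}$, by $q[(x,y),(z,y)]=p(x,z)$ if $x\neq y$, and $q[(y,y),(z,w)]=p(y,z)p(y,w)$; all other transitions have probability $0$. The first coordinate $(C_n)$ is a Markov chain with transition matrix $P$. $(C_n^* )$ is the reversed Markov chain, with transition matrix $p^*(x,y)=\frac{\pi(y)}{\pi(x)}p(y,x)$. For $y\in{\cal S}$, $H_y^*=\inf\{n>0: C_n^*=y\}$ and $H_y=\inf\{n>0: C_n=y\}$. $\mathbb{E}_x$ and $\mathbb{E}_\pi$ are expectations when the chain starts at $x$, respectively with distribution $\pi$. Reversible means $\pi(x)p(x,y)=\pi(y)p(y,x)$ for all $x,y$. *)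

theory Defs
  imports "HOL-Probability.Probability"
begin

section \<open>Finite transition matrices\<close>

definition distribution :: "('s::finite \<Rightarrow> real) \<Rightarrow> bool" where
  "distribution \<mu> \<longleftrightarrow> (\<forall>x. 0 \<le> \<mu> x) \<and> (\<Sum>x\<in>UNIV. \<mu> x) = 1"

definition transition_matrix :: "('s::finite \<Rightarrow> 's \<Rightarrow> real) \<Rightarrow> bool" where
  "transition_matrix p \<longleftrightarrow> (\<forall>x. distribution (p x))"

primrec n_step :: "('s::finite \<Rightarrow> 's \<Rightarrow> real) \<Rightarrow> nat \<Rightarrow> 's \<Rightarrow> 's \<Rightarrow> real" where
  "n_step p 0 x y = (if x = y then 1 else 0)"
| "n_step p (Suc n) x y = (\<Sum>z\<in>UNIV. p x z * n_step p n z y)"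

definition irreducible_matrix :: "('s::finite \<Rightarrow> 's \<Rightarrow> real) \<Rightarrow> bool" where
  "irreducible_matrix p \<longleftrightarrow> (\<forall>x y. \<exists>n. 0 < n_step p n x y)"

definition aperiodic_matrix :: "('s::finite \<Rightarrow> 's \<Rightarrow> real) \<Rightarrow> bool" where
  "aperiodic_matrix p \<longleftrightarrow> (\<forall>x. Gcd {n. 0 < n \<and> 0 < n_step p n x x} = 1)"

definition invariant_distribution :: "('s::finite \<Rightarrow> 's \<Rightarrow> real) \<Rightarrow> ('s \<Rightarrow> real) \<Rightarrow> bool" where
  "invariant_distribution p \<pi> \<longleftrightarrow> distribution \<pi> \<and> (\<forall>y. (\<Sum>x\<in>UNIV. \<pi> x * p x y) = \<pi> y)"

definition reversible_matrix :: "('s::finite \<Rightarrow> 's \<Rightarrow> real) \<Rightarrow> ('s \<Rightarrow> real) \<Rightarrow> bool" where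
  "reversible_matrix p \<pi> \<longleftrightarrow> (\<forall>x y. \<pi> x * p x y = \<pi> y * p y x)"

definition reversed_matrix :: "('s::finite \<Rightarrow> 's \<Rightarrow> real) \<Rightarrow> ('s \<Rightarrow> real) \<Rightarrow> 's \<Rightarrow> 's \<Rightarrow> real" where
  "reversed_matrix p \<pi> x y = \<pi> y / \<pi> x * p y x"

definition point_mass :: "'s::finite \<Rightarrow> 's \<Rightarrow> real" where
  "point_mass x y = (if y = x then 1 else 0)"

fun cat_mouse_matrix :: "('s::finite \<Rightarrow> 's \<Rightarrow> real) \<Rightarrow> 's \<times> 's \<Rightarrow> 's \<times> 's \<Rightarrow> real" where
  "cat_mouse_matrix p (x, y) (z, w) =
     (if x = y then p y z * p y w else if w = y then p x z else 0)"


section \<open>Markov chains and their path measures\<close>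

text \<open>The initial distribution is arbitrary.\<close>

definition markov_chain ::
    "'a measure \<Rightarrow> (nat \<Rightarrow> 'a \<Rightarrow> 's::finite) \<Rightarrow> ('s \<Rightarrow> 's \<Rightarrow> real) \<Rightarrow> bool" where
  "markov_chain M X p \<longleftrightarrow>
     prob_space M \<and>
     (\<forall>n. X n \<in> measurable M (count_space UNIV)) \<and>
     (\<forall>n x y. \<P>(\<omega> in M. \<forall>i\<le>n. X i \<omega> = x i) > 0 \<longrightarrow>
        \<P>(\<omega> in M. X (Suc n) \<omega> = y \<bar> \<forall>i\<le>n. X i \<omega> = x i) = p (x n) y)"

text \<open>
  The law on trajectories of the chain with transition matrix \<open>p\<close> and initial
  distribution \<open>\<mu>\<close>, obtained from the Ionescu-Tulcea construction: the coordinate at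
  time \<open>0\<close> is drawn from \<open>\<mu>\<close> and the one at time \<open>n > 0\<close> from row \<open>\<omega> (n - 1)\<close> of \<open>p\<close>.
  Integration against it is \<open>\<E>\<^sub>\<mu>\<close>; for \<open>\<mu> = point_mass x\<close> it is \<open>\<E>\<^sub>x\<close>.
  \<open>embed_pmf\<close> is meaningful only when \<open>\<mu>\<close> is a distribution and \<open>p\<close> a transition matrix.
\<close>

definition step_kernel ::
    "('s::finite \<Rightarrow> 's \<Rightarrow> real) \<Rightarrow> ('s \<Rightarrow> real) \<Rightarrow> nat \<Rightarrow> (nat \<Rightarrow> 's) \<Rightarrow> 's measure" where
  "step_kernel p \<mu> n \<omega> = measure_pmf (embed_pmf (if n = 0 then \<mu> else p (\<omega> (n - 1))))"

definition path_measure ::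
    "('s::finite \<Rightarrow> 's \<Rightarrow> real) \<Rightarrow> ('s \<Rightarrow> real) \<Rightarrow> (nat \<Rightarrow> 's) measure" where
  "path_measure p \<mu> =
     projective_family.lim UNIV (Ionescu_Tulcea.CI (step_kernel p \<mu>) (\<lambda>_. count_space UNIV))
       (\<lambda>_. count_space UNIV)"

text \<open>The first strictly positive time at which a trajectory visits \<open>y\<close>; \<open>\<infinity>\<close> if there is none.\<close>

definition hitting_time :: "'s \<Rightarrow> (nat \<Rightarrow> 's) \<Rightarrow> enat" where
  "hitting_time y \<omega> = Inf {enat n | n. 0 < n \<and> \<omega> n = y}"


section \<open>Convergence in distribution\<close>

text \<open>
  Weak convergence of the laws, tested against bounded continuous functions for the
  topology \<open>T\<close> (the library's \<open>weak_conv_m\<close> is restricted to laws on the real line).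
\<close>

definition converges_in_distribution ::
    "'b topology \<Rightarrow> 'a measure \<Rightarrow> (nat \<Rightarrow> 'a \<Rightarrow> 'b) \<Rightarrow> 'c measure \<Rightarrow> ('c \<Rightarrow> 'b) \<Rightarrow> bool" where
  "converges_in_distribution T M X M' Y \<longleftrightarrow>
     (\<forall>f. continuous_map T euclideanreal f \<and> bounded (f ` topspace T) \<longrightarrow>
        (\<lambda>n. \<integral>\<omega>. f (X n \<omega>) \<partial>M) \<longlonglongrightarrow> (\<integral>\<omega>. f (Y \<omega>) \<partial>M'))"


section \<open>Elementary facts about the definitions\<close>

lemma pmf_embed_distribution:
  assumes "distribution \<mu>"
  shows "pmf (embed_pmf \<mu>) x = \<mu> x"
proof (rule pmf_embed_pmf)
  show "0 \<le> \<mu> x" for x using assms by (simp add: distribution_def)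
  have "(\<integral>\<^sup>+x. ennreal (\<mu> x) \<partial>count_space UNIV) = ennreal (\<Sum>x\<in>UNIV. \<mu> x)"
    using assms by (simp add: nn_integral_count_space_finite distribution_def)
  then show "(\<integral>\<^sup>+x. ennreal (\<mu> x) \<partial>count_space UNIV) = 1"
    using assms by (simp add: distribution_def)
qed

lemma distribution_point_mass: "distribution (point_mass x)"
  by (simp add: distribution_def point_mass_def)

lemma transition_matrix_cat_mouse:
  assumes "transition_matrix p"
  shows "transition_matrix (cat_mouse_matrix p)"
proof -
  have nn: "0 \<le> p x y" and one: "(\<Sum>y\<in>UNIV. p x y) = 1" for x y
    using assms by (auto simp: transition_matrix_def distribution_def)
  have "distribution (cat_mouse_matrix p (x, y))" for x y
  proof -
    have "(\<Sum>s\<in>UNIV. cat_mouse_matrix p (x, y) s)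
        = (\<Sum>z\<in>UNIV. \<Sum>w\<in>UNIV. cat_mouse_matrix p (x, y) (z, w))"
      by (simp add: sum.cartesian_product flip: UNIV_Times_UNIV del: cat_mouse_matrix.simps)
    also have "\<dots> = 1"
      by (cases "x = y") (simp_all add: one flip: sum_distrib_left)
    finally show ?thesis
      using nn by (auto simp: distribution_def)
  qed
  then show ?thesis by (auto simp: transition_matrix_def)
qed

lemma transition_matrix_reversed:
  assumes "transition_matrix p" "invariant_distribution p \<pi>" "\<And>x. 0 < \<pi> x"
  shows "transition_matrix (reversed_matrix p \<pi>)"
proof -
  have "(\<Sum>y\<in>UNIV. \<pi> y / \<pi> x * p y x) = (\<Sum>y\<in>UNIV. \<pi> y * p y x) / \<pi> x" for x
    by (simp add: sum_divide_distrib)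
  also have "\<dots> x = 1" for x
    using assms(2) assms(3)[of x] by (simp add: invariant_distribution_def)
  finally have "(\<Sum>y\<in>UNIV. \<pi> y / \<pi> x * p y x) = 1" for x .
  then show ?thesis
    using assms by (auto simp: transition_matrix_def distribution_def reversed_matrix_def less_imp_le)
qed

text \<open>
  The path measure has the finite-dimensional distributions of the chain, and under it
  the coordinates form a Markov chain with the prescribed matrix and initial distribution.
\<close>

lemma Ionescu_Tulcea_step_kernel:
  "Ionescu_Tulcea (step_kernel p \<mu>) (\<lambda>_. count_space UNIV)"
proof (rule Ionescu_Tulcea.intro)
  fix n :: nat
  show "step_kernel p \<mu> n \<in> measurable (PiM {0..<n} (\<lambda>_. count_space UNIV))
      (subprob_algebra (count_space UNIV))"
  proof (cases n)
    case 0
    have "(\<lambda>_. measure_pmf (embed_pmf \<mu>)) \<in> measurable (PiM {0..<n} (\<lambda>_. count_space UNIV))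
        (subprob_algebra (count_space UNIV))"
      by (rule measurable_const) (simp add: space_subprob_algebra measure_pmf.subprob_space_axioms)
    then show ?thesis by (simp add: step_kernel_def[abs_def] 0)
  next
    case (Suc m)
    have "(\<lambda>\<omega>. \<omega> m) \<in> measurable (PiM {0..<n} (\<lambda>_. count_space UNIV)) (count_space UNIV)"
      using Suc by (intro measurable_component_singleton) simp
    moreover have "(\<lambda>y. measure_pmf (embed_pmf (p y)))
        \<in> measurable (count_space UNIV) (subprob_algebra (count_space UNIV))"
      by (simp add: space_subprob_algebra measure_pmf.subprob_space_axioms)
    ultimately have "(\<lambda>\<omega>. measure_pmf (embed_pmf (p (\<omega> m))))
        \<in> measurable (PiM {0..<n} (\<lambda>_. count_space UNIV)) (subprob_algebra (count_space UNIV))"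
      by (rule measurable_compose)
    then show ?thesis by (simp add: step_kernel_def[abs_def] Suc)
  qed
next
  fix n and \<omega> :: "nat \<Rightarrow> 'a"
  show "prob_space (step_kernel p \<mu> n \<omega>)"
    by (simp add: step_kernel_def measure_pmf.prob_space_axioms)
qed

lemma sets_path_measure [measurable_cong]:
  "sets (path_measure p \<mu>) = sets (PiM UNIV (\<lambda>_. count_space UNIV))"
proof -
  interpret IT: Ionescu_Tulcea "step_kernel p \<mu>" "\<lambda>_. count_space UNIV"
    by (rule Ionescu_Tulcea_step_kernel)
  show ?thesis unfolding path_measure_def by (rule IT.PF.sets_lim)
qed

lemma space_path_measure [simp]: "space (path_measure p \<mu>) = UNIV"
  using sets_eq_imp_space_eq[OF sets_path_measure[of p \<mu>]] by (simp add: space_PiM)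

lemma emeasure_path_measure:
  assumes "transition_matrix p" "distribution \<mu>"
  shows "emeasure (path_measure p \<mu>) {\<omega>. \<forall>i\<le>n. \<omega> i = x i}
      = ennreal (\<mu> (x 0) * (\<Prod>i<n. p (x i) (x (Suc i))))"
proof -
  let ?M = "\<lambda>_::nat. count_space (UNIV :: 'a set)"
  interpret IT: Ionescu_Tulcea "step_kernel p \<mu>" ?M
    by (rule Ionescu_Tulcea_step_kernel)
  have nn: "0 \<le> p y z" "0 \<le> \<mu> y" for y z
    using assms by (auto simp: transition_matrix_def distribution_def)
  have sets: "PiE {0..<m} (\<lambda>i. {x i}) \<in> sets (PiM {0..<m} ?M)" for m
    by (intro sets_PiM_I_finite) auto
  have C: "emeasure (IT.C 0 (Suc m) (\<lambda>_. undefined)) (PiE {0..<Suc m} (\<lambda>i. {x i}))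
      = ennreal (\<mu> (x 0) * (\<Prod>i<m. p (x i) (x (Suc i))))" for m
  proof -
    have step: "emeasure (IT.C 0 (Suc m) (\<lambda>_. undefined)) (PiE {0..<Suc m} (\<lambda>i. {x i}))
      = ennreal ((if m = 0 then \<mu> else p (x (m - 1))) (x m))
        * emeasure (IT.C 0 m (\<lambda>_. undefined)) (PiE {0..<m} (\<lambda>i. {x i}))" for m
    proof -
      let ?c = "ennreal ((if m = 0 then \<mu> else p (x (m - 1))) (x m))"
      let ?A = "PiE {0..<m} (\<lambda>i. {x i})"
      have u: "(\<lambda>_. undefined) \<in> space (PiM {0..<0} ?M)" by (simp add: space_PiM)
      note sp = IT.space_C[OF u, of m] and st = IT.sets_C[OF u, of m]
      have "emeasure (IT.C 0 (Suc m) (\<lambda>_. undefined)) (PiE {0..<Suc m} (\<lambda>i. {x i}))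
          = (\<integral>\<^sup>+\<omega>. emeasure (IT.eP m \<omega>) (PiE {0..<Suc m} (\<lambda>i. {x i}))
              \<partial>IT.C 0 m (\<lambda>_. undefined))"
        using IT.prob_space_C[OF u, of m, THEN prob_space.not_empty] IT.measurable_eP[of m]
        by (simp only: IT.C.simps add_0)
           (rule emeasure_bind[OF _ _ sets], simp_all cong: measurable_cong_sets add: st[simplified])
      also have "\<dots> = (\<integral>\<^sup>+\<omega>. ?c * indicator ?A \<omega> \<partial>IT.C 0 m (\<lambda>_. undefined))"
      proof (rule nn_integral_cong)
        fix \<omega> assume "\<omega> \<in> space (IT.C 0 m (\<lambda>_. undefined))"
        then have w: "\<omega> \<in> space (PiM {0..<m} ?M)" using sp by simp
        then have ext: "\<omega> \<in> extensional {0..<m}" by (simp add: space_PiM PiE_iff)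
        have upd: "fun_upd \<omega> m y \<in> PiE {0..<Suc m} (\<lambda>i. {x i}) \<longleftrightarrow> \<omega> \<in> ?A \<and> y = x m" for y
          using ext by (auto simp: PiE_iff extensional_def less_Suc_eq)
        have "emeasure (IT.eP m \<omega>) (PiE {0..<Suc m} (\<lambda>i. {x i}))
            = emeasure (step_kernel p \<mu> m \<omega>) {y. \<omega> \<in> ?A \<and> y = x m}"
          by (subst IT.emeasure_eP[OF w sets]) (simp add: vimage_def upd)
        also have "\<dots> = ?c * indicator ?A \<omega>"
        proof (cases "\<omega> \<in> ?A")
          case True
          then have "\<omega> (m - 1) = x (m - 1)" if "m \<noteq> 0" using that by (simp add: PiE_iff)
          moreover have "distribution \<mu>" "distribution (p z)" for z
            using assms by (auto simp: transition_matrix_def)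
          ultimately show ?thesis
            using True by (simp add: step_kernel_def emeasure_pmf_single pmf_embed_distribution)
        qed simp
        finally show "emeasure (IT.eP m \<omega>) (PiE {0..<Suc m} (\<lambda>i. {x i})) = ?c * indicator ?A \<omega>" .
      qed
      also have "\<dots> = ?c * emeasure (IT.C 0 m (\<lambda>_. undefined)) ?A"
        using sets[of m] st by (subst nn_integral_cmult_indicator) simp_all
      finally show ?thesis .
    qed
    show ?thesis
    proof (induction m)
      case 0
      have "emeasure (IT.C 0 0 (\<lambda>_. undefined)) (PiE {0..<0} (\<lambda>i. {x i})) = 1"
        by (simp add: PiM_empty)
      then show ?case by (simp only: step) simp
    next
      case (Suc m)
      show ?case
        by (subst step, subst Suc)
           (simp add: nn prod_nonneg ac_simps flip: ennreal_mult)
    qed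
  qed
  have "{\<omega>. \<forall>i\<le>n. \<omega> i = x i} = prod_emb UNIV ?M {0..<Suc n} (PiE {0..<Suc n} (\<lambda>i. {x i}))"
    by (auto simp: prod_emb_def PiE_iff less_Suc_eq_le restrict_def)
  then have "emeasure (path_measure p \<mu>) {\<omega>. \<forall>i\<le>n. \<omega> i = x i}
      = emeasure (IT.CI {0..<Suc n}) (PiE {0..<Suc n} (\<lambda>i. {x i}))"
    unfolding path_measure_def using IT.lim[OF _ sets[of "Suc n"]] by simp
  also have "\<dots> = emeasure (IT.C 0 (Suc n) (\<lambda>_. undefined)) (PiE {0..<Suc n} (\<lambda>i. {x i}))"
    using sets_PiM_I_finite[of "{0..<Suc n}" "\<lambda>i. {x i}" ?M]
    by (subst IT.emeasure_CI[OF subset_refl sets]) (simp add: prod_emb_PiE_same_index)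
  finally show ?thesis by (simp only: C)
qed

lemma prob_space_path_measure: "prob_space (path_measure p \<mu>)"
proof -
  interpret IT: Ionescu_Tulcea "step_kernel p \<mu>" "\<lambda>_. count_space UNIV"
    by (rule Ionescu_Tulcea_step_kernel)
  let ?M = "\<lambda>_::nat. count_space (UNIV :: 'a set)"
  have "emeasure (path_measure p \<mu>) (prod_emb UNIV ?M {} {\<lambda>_. undefined}) = emeasure (IT.CI {}) {\<lambda>_. undefined}"
    unfolding path_measure_def by (rule IT.lim) (auto simp: PiM_empty)
  also have "\<dots> = 1"
    using prob_space.emeasure_space_1[OF IT.PF.prob_space_P[of "{}"]] IT.PF.space_P[of "{}"]
    by (simp add: space_PiM)
  finally show ?thesis
    by (intro prob_spaceI) (simp add: prod_emb_def restrict_def)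
qed

lemma markov_chain_path_measure:
  assumes "transition_matrix p" "distribution \<mu>"
  shows "markov_chain (path_measure p \<mu>) (\<lambda>n \<omega>. \<omega> n) p"
    and "\<P>(\<omega> in path_measure p \<mu>. \<omega> 0 = x) = \<mu> x"
proof -
  have nn: "0 \<le> p y z" "0 \<le> \<mu> y" for y z
    using assms by (auto simp: transition_matrix_def distribution_def)
  have m: "measure (path_measure p \<mu>) {\<omega>. \<forall>i\<le>n. \<omega> i = x i}
      = \<mu> (x 0) * (\<Prod>i<n. p (x i) (x (Suc i)))" for n x
    by (simp add: measure_def emeasure_path_measure[OF assms] nn prod_nonneg)
  show "\<P>(\<omega> in path_measure p \<mu>. \<omega> 0 = x) = \<mu> x"
    using m[of 0 "\<lambda>_. x"] by simp
  show "markov_chain (path_measure p \<mu>) (\<lambda>n \<omega>. \<omega> n) p"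
    unfolding markov_chain_def
  proof (intro conjI allI impI)
    show "prob_space (path_measure p \<mu>)" by (rule prob_space_path_measure)
    show "(\<lambda>\<omega>. \<omega> n) \<in> measurable (path_measure p \<mu>) (count_space UNIV)" for n
      by measurable
    fix n x y
    assume pos: "\<P>(\<omega> in path_measure p \<mu>. \<forall>i\<le>n. \<omega> i = x i) > 0"
    have "{\<omega>. \<omega> (Suc n) = y \<and> (\<forall>i\<le>n. \<omega> i = x i)}
        = {\<omega>. \<forall>i\<le>Suc n. \<omega> i = fun_upd x (Suc n) y i}"
      by (auto simp: le_Suc_eq)
    then have "measure (path_measure p \<mu>) {\<omega>. \<omega> (Suc n) = y \<and> (\<forall>i\<le>n. \<omega> i = x i)}
        = measure (path_measure p \<mu>) {\<omega>. \<forall>i\<le>n. \<omega> i = x i} * p (x n) y"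
      by (simp only: m) simp
    then show "\<P>(\<omega> in path_measure p \<mu>. \<omega> (Suc n) = y \<bar> \<forall>i\<le>n. \<omega> i = x i) = p (x n) y"
      using pos by (simp add: cond_prob_def)
  qed
qed

end

theory Submission
  imports Defs
begin

text \<open>
  While the mouse sits at \<open>y\<close>, the cat is the chain \<open>p\<close> run until it hits \<open>y\<close>. An excursion of
  the pair with the mouse at \<open>y\<close> begins with a joint jump from some state \<open>a\<close> of the diagonal
  to \<open>(z, y)\<close>, which has probability \<open>p a z * p a y\<close>, and the expected number of times at which
  the cat is then at \<open>x\<close> is a Green function of the chain killed at \<open>y\<close>. If the diagonal carries
  the measure \<open>\<pi>\<close>, the pair therefore spends in \<open>(x, y)\<close> the time
  \<open>\<Sum>a. \<pi> a * p a y * green p y a x\<close>; this is \<open>cat_mouse_weight\<close>. Two identities make it an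
  invariant measure: the decomposition of the Green function at the last step
  (\<open>green_last_step\<close>), and its restriction to the diagonal being \<open>\<pi>\<close> again, because \<open>y\<close> is hit
  almost surely (\<open>green_taboo_state\<close>) and \<open>\<pi>\<close> is invariant for \<open>p\<close>.

  The expectations of the theorem are read off from the same Green function. The law of a
  trajectory up to its first visit to \<open>y\<close> is given by the powers of the killed matrix
  (\<open>measure_path_taboo\<close>), and reversing time transposes these powers with respect to \<open>\<pi>\<close>
  (\<open>taboo_reversed\<close>). So \<open>\<pi> x\<close> times the expectation for the reversed chain is the weight of
  \<open>(x, y)\<close>, and \<open>\<alpha>\<close> is the total weight.

  Convergence is a Doeblin argument in total variation. It needs a number of steps after which
  one state has positive probability whatever the start. The cat can walk to the mouse; and since
  the two jumps from the diagonal are independent, they may agree, so every path of \<open>p\<close> lifts to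
  a path along the diagonal. The period of the pair is therefore that of \<open>p\<close>, namely \<open>1\<close>
  (\<open>cat_mouse_doeblin\<close>).

  For a reversible chain, \<open>\<pi> a * p a y = \<pi> y * p y a\<close> turns the weight of the column \<open>y\<close> into
  \<open>\<pi> y * (r - 1)\<close>, where \<open>r\<close> is the expected return time to \<open>y\<close>. Kac's formula \<open>\<pi> y * r = 1\<close> makes
  this \<open>1 - \<pi> y\<close>, and summing over \<open>y\<close> gives \<open>\<alpha> = N - 1\<close>.
\<close>

section \<open>Powers of a transition matrix\<close>

lemma transition_matrixD:
  assumes "transition_matrix p"
  shows "0 \<le> p x y" "(\<Sum>y\<in>UNIV. p x y) = 1"
  using assms by (auto simp: transition_matrix_def distribution_def)

lemma n_step_nonneg:
  assumes "transition_matrix p" shows "0 \<le> n_step p n x y"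
  by (induction n arbitrary: x) (auto intro!: sum_nonneg simp: transition_matrixD[OF assms])

lemma n_step_add:
  "n_step p (m + n) x z = (\<Sum>y\<in>UNIV. n_step p m x y * n_step p n y z)"
proof (induction m arbitrary: x)
  case 0
  have "(\<Sum>y\<in>UNIV. n_step p 0 x y * n_step p n y z) = (\<Sum>y\<in>UNIV. if x = y then n_step p n y z else 0)"
    by (rule sum.cong) auto
  then show ?case by simp
next
  case (Suc m)
  have "n_step p (Suc m + n) x z = (\<Sum>v\<in>UNIV. \<Sum>y\<in>UNIV. p x v * (n_step p m v y * n_step p n y z))"
    by (simp add: Suc sum_distrib_left)
  also have "\<dots> = (\<Sum>y\<in>UNIV. n_step p (Suc m) x y * n_step p n y z)"
    by (subst sum.swap) (simp add: sum_distrib_right mult.assoc)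
  finally show ?case .
qed

lemma n_step_pos_add:
  assumes "transition_matrix p" "0 < n_step p m x y" "0 < n_step p n y z"
  shows "0 < n_step p (m + n) x z"
  unfolding n_step_add
  by (rule sum_pos2[of _ y]) (use assms in \<open>auto simp: n_step_nonneg\<close>)

lemma n_step_pos_Suc_iff:
  assumes "transition_matrix p"
  shows "0 < n_step p (Suc n) x z \<longleftrightarrow> (\<exists>y. 0 < p x y \<and> 0 < n_step p n y z)"
proof
  assume "0 < n_step p (Suc n) x z"
  then obtain y where "0 < p x y * n_step p n y z"
    by (metis (mono_tags, lifting) n_step.simps(2) not_le sum_nonpos)
  then show "\<exists>y. 0 < p x y \<and> 0 < n_step p n y z"
    using transition_matrixD(1)[OF assms, of x y] by (auto simp: zero_less_mult_iff)
next
  assume "\<exists>y. 0 < p x y \<and> 0 < n_step p n y z"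
  then obtain y where y: "0 < p x y" "0 < n_step p n y z" by blast
  show "0 < n_step p (Suc n) x z"
    unfolding n_step.simps
    by (rule sum_pos2[of _ y]) (use y in \<open>auto simp: n_step_nonneg[OF assms] transition_matrixD[OF assms]\<close>)
qed

lemma n_step_row_sum:
  assumes "transition_matrix p" shows "(\<Sum>y\<in>UNIV. n_step p n x y) = 1"
proof (induction n arbitrary: x)
  case (Suc n)
  have "(\<Sum>y\<in>UNIV. n_step p (Suc n) x y) = (\<Sum>z\<in>UNIV. p x z * (\<Sum>y\<in>UNIV. n_step p n z y))"
    unfolding n_step.simps by (subst sum.swap) (simp add: sum_distrib_left)
  then show ?case by (simp add: Suc transition_matrixD[OF assms])
qed simp

lemma n_step_evolution:
  assumes "\<And>n t. \<mu> (Suc n) t = (\<Sum>s\<in>UNIV. \<mu> n s * q s t)"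
  shows "\<mu> (n + k) t = (\<Sum>s\<in>UNIV. \<mu> n s * n_step q k s t)"
proof (induction k arbitrary: n)
  case 0
  have "(\<Sum>s\<in>UNIV. \<mu> n s * n_step q 0 s t) = (\<Sum>s\<in>UNIV. if s = t then \<mu> n s else 0)"
    by (rule sum.cong) auto
  then show ?case by simp
next
  case (Suc k)
  have "\<mu> (n + Suc k) t = (\<Sum>v\<in>UNIV. \<Sum>s\<in>UNIV. \<mu> n s * q s v * n_step q k v t)"
    using Suc[of "Suc n"] by (simp add: assms sum_distrib_right)
  also have "\<dots> = (\<Sum>s\<in>UNIV. \<mu> n s * n_step q (Suc k) s t)"
    by (subst sum.swap) (simp add: sum_distrib_left mult.assoc)
  finally show ?case .
qed

section \<open>The Markov property for events of the past\<close>

lemma markov_chain_cylinder_step: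
  fixes p :: "'s::finite \<Rightarrow> 's \<Rightarrow> real"
  assumes "markov_chain M X p"
  shows "measure M {w \<in> space M. X (Suc n) w = y \<and> (\<forall>i\<le>n. X i w = f i)}
       = measure M {w \<in> space M. \<forall>i\<le>n. X i w = f i} * p (f n) y"
proof -
  interpret prob_space M using assms by (simp add: markov_chain_def)
  have [measurable]: "X i \<in> measurable M (count_space UNIV)" for i
    using assms by (simp add: markov_chain_def)
  show ?thesis
  proof (cases "measure M {w \<in> space M. \<forall>i\<le>n. X i w = f i} > 0")
    case True
    then show ?thesis
      using assms unfolding markov_chain_def cond_prob_def by (auto simp: field_simps)
  next
    case False
    then have 0: "measure M {w \<in> space M. \<forall>i\<le>n. X i w = f i} = 0"
      using measure_nonneg[of M] by (meson linorder_not_less order_antisym)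
    have "measure M {w \<in> space M. X (Suc n) w = y \<and> (\<forall>i\<le>n. X i w = f i)}
        \<le> measure M {w \<in> space M. \<forall>i\<le>n. X i w = f i}"
      by (rule finite_measure_mono) auto
    then show ?thesis using 0 by (simp add: measure_le_0_iff)
  qed
qed

text \<open>
  The definition of a Markov chain conditions on a single past trajectory. An event of the past
  is a finite disjoint union of such cylinders, because the state space is finite.
\<close>

lemma markov_chain_measure_past:
  fixes p :: "'s::finite \<Rightarrow> 's \<Rightarrow> real"
  assumes "markov_chain M X p"
    and A: "\<And>f g. (\<And>i. i \<le> n \<Longrightarrow> f i = g i) \<Longrightarrow> A f \<longleftrightarrow> A g"
  shows "measure M {w \<in> space M. A (\<lambda>i. X i w) \<and> X n w = x \<and> X (Suc n) w = y}
       = measure M {w \<in> space M. A (\<lambda>i. X i w) \<and> X n w = x} * p x y"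
proof -
  interpret prob_space M using assms by (simp add: markov_chain_def)
  have [measurable]: "X i \<in> measurable M (count_space UNIV)" for i
    using assms by (simp add: markov_chain_def)
  define F where "F = {f \<in> PiE {..n} (\<lambda>_. UNIV :: 's set). A f \<and> f n = x}"
  have F: "finite F" unfolding F_def by (auto intro!: finite_subset[OF _ finite_PiE[of "{..n}" "\<lambda>_. UNIV"]])
  have dec: "{w \<in> space M. A (\<lambda>i. X i w) \<and> X n w = x \<and> R w}
      = (\<Union>f\<in>F. {w \<in> space M. R w \<and> (\<forall>i\<le>n. X i w = f i)})" for R
  proof (intro set_eqI iffI)
    fix w assume w: "w \<in> {w \<in> space M. A (\<lambda>i. X i w) \<and> X n w = x \<and> R w}"
    have "A (restrict (\<lambda>i. X i w) {..n}) \<longleftrightarrow> A (\<lambda>i. X i w)" by (rule A) simp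
    then have "restrict (\<lambda>i. X i w) {..n} \<in> F" using w by (auto simp: F_def)
    then show "w \<in> (\<Union>f\<in>F. {w \<in> space M. R w \<and> (\<forall>i\<le>n. X i w = f i)})"
      using w by (intro UN_I[of "restrict (\<lambda>i. X i w) {..n}"]) auto
  next
    fix w assume "w \<in> (\<Union>f\<in>F. {w \<in> space M. R w \<and> (\<forall>i\<le>n. X i w = f i)})"
    then obtain f where f: "f \<in> F" "w \<in> space M" "R w" "\<And>i. i \<le> n \<Longrightarrow> X i w = f i" by auto
    have "A (\<lambda>i. X i w) \<longleftrightarrow> A f" by (rule A) (simp add: f)
    then show "w \<in> {w \<in> space M. A (\<lambda>i. X i w) \<and> X n w = x \<and> R w}"
      using f by (auto simp: F_def)
  qed
  have disj: "disjoint_family_on (\<lambda>f. {w \<in> space M. R w \<and> (\<forall>i\<le>n. X i w = f i)}) F" for R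
  proof -
    have "f = g" if "f \<in> F" "g \<in> F" "\<forall>i\<le>n. X i w = f i" "\<forall>i\<le>n. X i w = g i" for f g w
    proof (rule PiE_ext[of f "{..n}" "\<lambda>_. UNIV" g])
      show "f i = g i" if "i \<in> {..n}" for i using that \<open>\<forall>i\<le>n. X i w = f i\<close> \<open>\<forall>i\<le>n. X i w = g i\<close> by auto
    qed (use that in \<open>auto simp: F_def\<close>)
    then show ?thesis unfolding disjoint_family_on_def by blast
  qed
  have "measure M {w \<in> space M. A (\<lambda>i. X i w) \<and> X n w = x \<and> X (Suc n) w = y}
      = (\<Sum>f\<in>F. measure M {w \<in> space M. X (Suc n) w = y \<and> (\<forall>i\<le>n. X i w = f i)})"
    unfolding dec by (rule finite_measure_finite_Union[OF F _ disj]) auto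
  also have "\<dots> = (\<Sum>f\<in>F. measure M {w \<in> space M. True \<and> (\<forall>i\<le>n. X i w = f i)} * p x y)"
    by (rule sum.cong) (simp_all add: markov_chain_cylinder_step[OF assms(1)] F_def)
  also have "\<dots> = measure M (\<Union>f\<in>F. {w \<in> space M. True \<and> (\<forall>i\<le>n. X i w = f i)}) * p x y"
    unfolding sum_distrib_right[symmetric]
    by (subst finite_measure_finite_Union[OF F _ disj]) auto
  finally show ?thesis unfolding dec[symmetric] by simp
qed

lemma measure_split_value:
  fixes Y :: "'a \<Rightarrow> 's::finite"
  assumes "prob_space M" "Y \<in> measurable M (count_space UNIV)" "{w \<in> space M. R w} \<in> sets M"
  shows "measure M {w \<in> space M. Y w \<in> B \<and> R w} = (\<Sum>x\<in>B. measure M {w \<in> space M. R w \<and> Y w = x})"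
proof -
  interpret prob_space M by fact
  note assms(2)[measurable]
  have [measurable]: "Measurable.pred M R" using assms(3) by (simp add: pred_def)
  have "{w \<in> space M. Y w \<in> B \<and> R w} = (\<Union>x\<in>B. {w \<in> space M. R w \<and> Y w = x})" by auto
  then show ?thesis
    by (simp only:) (rule finite_measure_finite_Union, auto simp: disjoint_family_on_def)
qed

lemma markov_chain_law_step:
  fixes p :: "'s::finite \<Rightarrow> 's \<Rightarrow> real"
  assumes "markov_chain M X p"
  shows "measure M {w \<in> space M. X (Suc n) w = y}
       = (\<Sum>x\<in>UNIV. measure M {w \<in> space M. X n w = x} * p x y)"
proof -
  have [measurable]: "X i \<in> measurable M (count_space UNIV)" for i
    using assms by (simp add: markov_chain_def)
  have "measure M {w \<in> space M. X n w \<in> UNIV \<and> X (Suc n) w = y}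
      = (\<Sum>x\<in>UNIV. measure M {w \<in> space M. X (Suc n) w = y \<and> X n w = x})"
    by (rule measure_split_value) (use assms in \<open>auto simp: markov_chain_def\<close>)
  also have "\<dots> = (\<Sum>x\<in>UNIV. measure M {w \<in> space M. X n w = x} * p x y)"
    using markov_chain_measure_past[OF assms, of n "\<lambda>_. True"] by (simp add: conj_commute)
  finally show ?thesis by simp
qed

section \<open>Chains killed at a state\<close>

text \<open>
  \<open>taboo p y n x z\<close> is the probability that the chain from \<open>x\<close> is at \<open>z\<close> at time \<open>n + 1\<close> and has
  not been at \<open>y\<close> at the times \<open>1, \<dots>, n\<close>. The shift by one makes the event at time \<open>n + 1\<close> the
  event that the hitting time of \<open>y\<close>, which ignores time \<open>0\<close>, is at least \<open>n + 1\<close>; in particular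
  arriving at \<open>z = y\<close> is counted.
\<close>

primrec taboo :: "('s::finite \<Rightarrow> 's \<Rightarrow> real) \<Rightarrow> 's \<Rightarrow> nat \<Rightarrow> 's \<Rightarrow> 's \<Rightarrow> real" where
  "taboo p y 0 x z = p x z"
| "taboo p y (Suc n) x z = (\<Sum>w\<in>-{y}. taboo p y n x w * p w z)"

definition green :: "('s::finite \<Rightarrow> 's \<Rightarrow> real) \<Rightarrow> 's \<Rightarrow> 's \<Rightarrow> 's \<Rightarrow> real" where
  "green p y x z = (\<Sum>n. taboo p y n x z)"

lemma taboo_nonneg:
  assumes "transition_matrix p" shows "0 \<le> taboo p y n x z"
  by (induction n arbitrary: z) (auto intro!: sum_nonneg simp: transition_matrixD[OF assms])

lemma taboo_Suc_left: "taboo p y (Suc n) x z = (\<Sum>w\<in>-{y}. p x w * taboo p y n w z)"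
proof (induction n arbitrary: z)
  case (Suc n)
  have "taboo p y (Suc (Suc n)) x z = (\<Sum>w\<in>-{y}. \<Sum>v\<in>-{y}. p x v * taboo p y n v w * p w z)"
    unfolding taboo.simps(2)[of p y "Suc n"] Suc by (simp add: sum_distrib_right)
  also have "\<dots> = (\<Sum>v\<in>-{y}. p x v * taboo p y (Suc n) v z)"
    by (subst sum.swap) (simp add: sum_distrib_left mult.assoc)
  finally show ?case .
qed simp

text \<open>
  Each path from \<open>x\<close> to \<open>z\<close> has, under the reversed chain, \<open>\<pi> z / \<pi> x\<close> times the probability of
  the path read backwards under \<open>p\<close>, and reading backwards preserves the set of intermediate
  states. In the induction the last step of the one is the first step of the other.
\<close>

lemma taboo_reversed:
  assumes pos: "\<And>x. 0 < \<pi> x"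
  shows "\<pi> x * taboo (reversed_matrix p \<pi>) y n x z = \<pi> z * taboo p y n z x"
proof (induction n arbitrary: z)
  case 0
  show ?case using pos[of x] by (simp add: reversed_matrix_def)
next
  case (Suc n)
  have "\<pi> x * taboo (reversed_matrix p \<pi>) y (Suc n) x z
      = (\<Sum>w\<in>-{y}. \<pi> x * taboo (reversed_matrix p \<pi>) y n x w * reversed_matrix p \<pi> w z)"
    by (simp add: sum_distrib_left mult.assoc)
  also have "\<dots> = (\<Sum>w\<in>-{y}. \<pi> z * (p z w * taboo p y n w x))"
  proof (rule sum.cong[OF refl])
    fix w
    show "\<pi> x * taboo (reversed_matrix p \<pi>) y n x w * reversed_matrix p \<pi> w z
        = \<pi> z * (p z w * taboo p y n w x)"
      using pos[of w] unfolding Suc by (simp add: reversed_matrix_def)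
  qed
  finally show ?case unfolding taboo_Suc_left by (simp add: sum_distrib_left)
qed

lemma sum_Compl_singleton:
  fixes f :: "'s::finite \<Rightarrow> real"
  shows "(\<Sum>w\<in>-{y}. f w) = (\<Sum>w\<in>UNIV. f w) - f y"
  by (simp add: sum_diff1 Compl_eq_Diff_UNIV)

text \<open>
  The mass lost at each step is the mass that has just arrived at \<open>y\<close>; the telescoping sum below
  is the law of the hitting time.
\<close>

lemma taboo_mass_Suc:
  assumes "transition_matrix p"
  shows "(\<Sum>z\<in>UNIV. taboo p y (Suc n) x z) = (\<Sum>z\<in>UNIV. taboo p y n x z) - taboo p y n x y"
proof -
  have "(\<Sum>z\<in>UNIV. taboo p y (Suc n) x z) = (\<Sum>w\<in>-{y}. \<Sum>z\<in>UNIV. taboo p y n x w * p w z)"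
    unfolding taboo.simps by (rule sum.swap)
  also have "\<dots> = (\<Sum>w\<in>-{y}. taboo p y n x w)"
    by (simp add: sum_distrib_left[symmetric] transition_matrixD[OF assms])
  finally show ?thesis by (simp add: sum_Compl_singleton)
qed

lemma taboo_telescope:
  assumes "transition_matrix p"
  shows "(\<Sum>k<n. taboo p y k x y) = 1 - (\<Sum>z\<in>UNIV. taboo p y n x z)"
  by (induction n) (simp_all add: transition_matrixD[OF assms] taboo_mass_Suc[OF assms] del: taboo.simps(2))

text \<open>
  By telescoping, the visits to \<open>y\<close> itself sum to at most \<open>1\<close>. A bound at \<open>z'\<close> gives one at every
  \<open>z \<noteq> y\<close> that leads to \<open>z'\<close> in one step, so the bound propagates backwards along a path from \<open>z\<close>
  to \<open>y\<close>, and irreducibility provides such a path.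
\<close>

lemma summable_taboo:
  assumes p: "transition_matrix p" and "irreducible_matrix p"
  shows "summable (\<lambda>n. taboo p y n x z)"
proof -
  have y: "summable (\<lambda>n. taboo p y n x y)"
    by (rule summableI_nonneg_bounded[of _ 1])
       (auto simp: taboo_nonneg[OF p] taboo_telescope[OF p] sum_nonneg)
  have "summable (\<lambda>n. taboo p y n x z)" if "0 < n_step p m z y" for m
    using that
  proof (induction m arbitrary: z)
    case 0
    then show ?case using y by (auto split: if_splits)
  next
    case (Suc m)
    show ?case
    proof (cases "z = y")
      case False
      obtain z' where pos: "0 < p z z'" and "0 < n_step p m z' y"
        using iffD1[OF n_step_pos_Suc_iff[OF p] Suc.prems] by blast
      then have *: "summable (\<lambda>n. taboo p y (Suc n) x z')"
        using Suc.IH summable_Suc_iff[of "\<lambda>n. taboo p y n x z'"] by simp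
      have "taboo p y n x z * p z z' \<le> taboo p y (Suc n) x z'" for n
        unfolding taboo.simps using False
        by (intro member_le_sum) (auto simp: taboo_nonneg[OF p] transition_matrixD(1)[OF p])
      then have "norm (taboo p y n x z * p z z') \<le> taboo p y (Suc n) x z'" for n
        using taboo_nonneg[OF p] transition_matrixD(1)[OF p] by (simp only: real_norm_def abs_of_nonneg mult_nonneg_nonneg)
      then have "summable (\<lambda>n. taboo p y n x z * p z z')"
        by (rule summable_comparison_test'[OF *])
      then show ?thesis
        using pos summable_mult_D[of "p z z'" "\<lambda>n. taboo p y n x z"] by (simp only: mult.commute)
    qed (simp add: y)
  qed
  then show ?thesis using assms(2) unfolding irreducible_matrix_def by blast
qed

lemma taboo_mass_tendsto_0:
  assumes "transition_matrix p" "irreducible_matrix p"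
  shows "(\<lambda>n. \<Sum>z\<in>UNIV. taboo p y n x z) \<longlonglongrightarrow> 0"
  by (rule tendsto_null_sum) (rule summable_LIMSEQ_zero[OF summable_taboo[OF assms]])

text \<open>
  The chain hits \<open>y\<close> almost surely: the mass that has not yet arrived tends to \<open>0\<close>.
\<close>

lemma green_taboo_state:
  assumes "transition_matrix p" "irreducible_matrix p"
  shows "green p y x y = 1"
proof -
  have "(\<lambda>n. 1 - (\<Sum>z\<in>UNIV. taboo p y n x z)) \<longlonglongrightarrow> 1 - 0"
    by (intro tendsto_intros taboo_mass_tendsto_0 assms)
  then have "(\<lambda>n. taboo p y n x y) sums 1"
    unfolding sums_def taboo_telescope[OF assms(1)] by simp
  then show ?thesis by (simp add: green_def sums_iff)
qed

lemma green_nonneg: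
  assumes "transition_matrix p" "irreducible_matrix p"
  shows "0 \<le> green p y x z"
  unfolding green_def by (intro suminf_nonneg summable_taboo assms taboo_nonneg)

lemma green_last_step:
  assumes "transition_matrix p" "irreducible_matrix p"
  shows "green p y x z = p x z + (\<Sum>w\<in>-{y}. green p y x w * p w z)"
proof -
  have "green p y x z = (\<Sum>n. taboo p y (Suc n) x z) + taboo p y 0 x z"
    unfolding green_def using suminf_split_head[OF summable_taboo[OF assms], of y x z] by simp
  also have "(\<Sum>n. taboo p y (Suc n) x z) = (\<Sum>w\<in>-{y}. \<Sum>n. taboo p y n x w * p w z)"
    unfolding taboo.simps by (rule suminf_sum) (intro summable_mult2 summable_taboo assms)
  also have "\<dots> = (\<Sum>w\<in>-{y}. green p y x w * p w z)"
    unfolding green_def by (intro sum.cong refl suminf_mult2[symmetric] summable_taboo assms)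
  finally show ?thesis by simp
qed

section \<open>Path functionals\<close>

lemma Suc_le_hitting_time:
  "enat (Suc n) \<le> hitting_time y \<omega> \<longleftrightarrow> (\<forall>i. 0 < i \<and> i \<le> n \<longrightarrow> \<omega> i \<noteq> y)"
proof
  assume *: "enat (Suc n) \<le> hitting_time y \<omega>"
  show "\<forall>i. 0 < i \<and> i \<le> n \<longrightarrow> \<omega> i \<noteq> y"
  proof (intro allI impI notI)
    fix i assume i: "0 < i \<and> i \<le> n" "\<omega> i = y"
    then have "hitting_time y \<omega> \<le> enat i"
      unfolding hitting_time_def by (intro Inf_lower) auto
    with * i show False by (meson enat_ord_simps(1) le_trans not_less_eq_eq order_trans)
  qed
next
  assume *: "\<forall>i. 0 < i \<and> i \<le> n \<longrightarrow> \<omega> i \<noteq> y"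
  show "enat (Suc n) \<le> hitting_time y \<omega>"
    unfolding hitting_time_def
  proof (rule Inf_greatest)
    fix e assume "e \<in> {enat n |n. 0 < n \<and> \<omega> n = y}"
    then show "enat (Suc n) \<le> e" using * by (auto simp: not_less_eq_eq[symmetric])
  qed
qed

lemma measure_path_taboo:
  assumes p: "transition_matrix p" and \<mu>: "distribution \<mu>"
  shows "measure (path_measure p \<mu>) {\<omega>. \<omega> 0 = a \<and> enat (Suc n) \<le> hitting_time y \<omega> \<and> \<omega> (Suc n) = z}
       = \<mu> a * taboo p y n a z"
proof -
  let ?M = "path_measure p \<mu>"
  note mc = markov_chain_path_measure(1)[OF assms]
  show ?thesis unfolding Suc_le_hitting_time
  proof (induction n arbitrary: z)
    case 0
    show ?case
      using markov_chain_measure_past[OF mc, of 0 "\<lambda>_. True" a z]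
        markov_chain_path_measure(2)[OF assms, of a]
      by simp
  next
    case (Suc n)
    let ?A = "\<lambda>\<omega>. \<omega> 0 = a \<and> (\<forall>i. 0 < i \<and> i \<le> n \<longrightarrow> \<omega> i \<noteq> y)"
    have eq: "{\<omega>. \<omega> 0 = a \<and> (\<forall>i. 0 < i \<and> i \<le> Suc n \<longrightarrow> \<omega> i \<noteq> y) \<and> \<omega> (Suc (Suc n)) = z}
        = {\<omega> \<in> space ?M. \<omega> (Suc n) \<in> - {y} \<and> (?A \<omega> \<and> \<omega> (Suc (Suc n)) = z)}"
      by (auto simp: le_Suc_eq)
    have "measure ?M {\<omega> \<in> space ?M. \<omega> (Suc n) \<in> - {y} \<and> (?A \<omega> \<and> \<omega> (Suc (Suc n)) = z)}
        = (\<Sum>w\<in>-{y}. measure ?M {\<omega> \<in> space ?M. (?A \<omega> \<and> \<omega> (Suc (Suc n)) = z) \<and> \<omega> (Suc n) = w})"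
      by (rule measure_split_value[OF prob_space_path_measure]; measurable)
    also have "\<dots> = (\<Sum>w\<in>-{y}. measure ?M {\<omega> \<in> space ?M. ?A \<omega> \<and> \<omega> (Suc n) = w} * p w z)"
    proof (rule sum.cong[OF refl])
      fix w
      have "measure ?M {\<omega> \<in> space ?M. ?A \<omega> \<and> \<omega> (Suc n) = w \<and> \<omega> (Suc (Suc n)) = z}
          = measure ?M {\<omega> \<in> space ?M. ?A \<omega> \<and> \<omega> (Suc n) = w} * p w z"
      proof (rule markov_chain_measure_past[OF mc, where A = ?A])
        fix f g :: "nat \<Rightarrow> 'a" assume fg: "\<And>i. i \<le> Suc n \<Longrightarrow> f i = g i"
        have "f i = g i" if "i \<le> n" for i using fg[of i] that by simp
        then show "?A f \<longleftrightarrow> ?A g" by auto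
      qed
      then show "measure ?M {\<omega> \<in> space ?M. (?A \<omega> \<and> \<omega> (Suc (Suc n)) = z) \<and> \<omega> (Suc n) = w}
          = measure ?M {\<omega> \<in> space ?M. ?A \<omega> \<and> \<omega> (Suc n) = w} * p w z"
        by (simp add: conj_ac)
    qed
    also have "\<dots> = (\<Sum>w\<in>-{y}. \<mu> a * taboo p y n a w * p w z)"
      using Suc by simp
    finally show ?case unfolding eq by (simp add: sum_distrib_left mult.assoc)
  qed
qed

lemma sets_before_hitting:
  "{\<omega>. \<omega> 0 = a \<and> enat (Suc n) \<le> hitting_time y \<omega> \<and> \<omega> (Suc n) = z} \<in> sets (path_measure p \<mu>)"
proof -
  have "{\<omega> \<in> space (path_measure p \<mu>). \<omega> 0 = a \<and> (\<forall>i. 0 < i \<and> i \<le> n \<longrightarrow> \<omega> i \<noteq> y) \<and> \<omega> (Suc n) = z}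
      \<in> sets (path_measure p \<mu>)"
    by measurable
  then show ?thesis by (simp add: Suc_le_hitting_time)
qed

text \<open>
  Writing the functional as a finite combination of indicators gives both its measurability and
  its integral, through the probabilities of \<open>measure_path_taboo\<close>.
\<close>

lemma path_function_eq_sum_indicator:
  fixes g :: "'s::finite \<Rightarrow> 's \<Rightarrow> real"
  shows "(if enat (Suc n) \<le> hitting_time y \<omega> then ennreal (g (\<omega> 0) (\<omega> (Suc n))) else 0)
       = (\<Sum>a\<in>UNIV. \<Sum>z\<in>UNIV. ennreal (g a z)
           * indicator {\<omega>. \<omega> 0 = a \<and> enat (Suc n) \<le> hitting_time y \<omega> \<and> \<omega> (Suc n) = z} \<omega>)"
    (is "_ = (\<Sum>a\<in>UNIV. \<Sum>z\<in>UNIV. _ * indicator (?E a z) \<omega>)")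
proof -
  have "(\<Sum>a\<in>UNIV. \<Sum>z\<in>UNIV. ennreal (g a z) * indicator (?E a z) \<omega>)
      = (\<Sum>a\<in>UNIV. if a = \<omega> 0 then (\<Sum>z\<in>UNIV. if z = \<omega> (Suc n) then
          (if enat (Suc n) \<le> hitting_time y \<omega> then ennreal (g a z) else 0) else 0) else 0)"
    by (intro sum.cong refl) (auto simp: indicator_def intro!: sum.cong)
  then show ?thesis by simp
qed

lemma borel_measurable_before_hitting:
  "(\<lambda>\<omega>. ennreal c * indicator {\<omega>. \<omega> 0 = a \<and> enat (Suc n) \<le> hitting_time y \<omega> \<and> \<omega> (Suc n) = z} \<omega>)
    \<in> borel_measurable (path_measure p \<mu>)"
  by (intro borel_measurable_times_ennreal borel_measurable_const borel_measurable_indicator sets_before_hitting)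

lemma nn_integral_path_before_hitting:
  assumes p: "transition_matrix p" and \<mu>: "distribution \<mu>" and g: "\<And>a z. 0 \<le> g a z"
  shows "(\<integral>\<^sup>+\<omega>. (if enat (Suc n) \<le> hitting_time y \<omega> then ennreal (g (\<omega> 0) (\<omega> (Suc n))) else 0) \<partial>path_measure p \<mu>)
       = ennreal (\<Sum>a\<in>UNIV. \<Sum>z\<in>UNIV. \<mu> a * taboo p y n a z * g a z)"
proof -
  let ?M = "path_measure p \<mu>"
  let ?E = "\<lambda>a z. {\<omega>. \<omega> 0 = a \<and> enat (Suc n) \<le> hitting_time y \<omega> \<and> \<omega> (Suc n) = z}"
  interpret prob_space ?M by (rule prob_space_path_measure)
  note m = borel_measurable_before_hitting[of _ _ n y _ p \<mu>]
  have "(\<integral>\<^sup>+\<omega>. (if enat (Suc n) \<le> hitting_time y \<omega> then ennreal (g (\<omega> 0) (\<omega> (Suc n))) else 0) \<partial>?M)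
      = (\<integral>\<^sup>+\<omega>. (\<Sum>a\<in>UNIV. \<Sum>z\<in>UNIV. ennreal (g a z) * indicator (?E a z) \<omega>) \<partial>?M)"
    unfolding path_function_eq_sum_indicator ..
  also have "\<dots> = (\<Sum>a\<in>UNIV. \<Sum>z\<in>UNIV. \<integral>\<^sup>+\<omega>. ennreal (g a z) * indicator (?E a z) \<omega> \<partial>?M)"
  proof (subst nn_integral_sum)
    show "(\<lambda>\<omega>. \<Sum>z\<in>UNIV. ennreal (g a z) * indicator (?E a z) \<omega>) \<in> borel_measurable ?M" for a
      by (intro borel_measurable_sum m)
    show "(\<Sum>a\<in>UNIV. \<integral>\<^sup>+\<omega>. (\<Sum>z\<in>UNIV. ennreal (g a z) * indicator (?E a z) \<omega>) \<partial>?M)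
        = (\<Sum>a\<in>UNIV. \<Sum>z\<in>UNIV. \<integral>\<^sup>+\<omega>. ennreal (g a z) * indicator (?E a z) \<omega> \<partial>?M)"
      by (intro sum.cong refl nn_integral_sum m)
  qed
  also have "\<dots> = (\<Sum>a\<in>UNIV. \<Sum>z\<in>UNIV. ennreal (\<mu> a * taboo p y n a z * g a z))"
    by (simp add: sets_before_hitting nn_integral_cmult_indicator emeasure_eq_measure
        measure_path_taboo[OF p \<mu>] ennreal_mult'[OF g, symmetric] mult.commute)
  also have "\<dots> = ennreal (\<Sum>a\<in>UNIV. \<Sum>z\<in>UNIV. \<mu> a * taboo p y n a z * g a z)"
    using g \<mu> taboo_nonneg[OF p] by (simp add: sum_ennreal sum_nonneg distribution_def)
  finally show ?thesis .
qed

text \<open>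
  With \<open>g a z = p z y\<close> this evaluates the expectations for the reversed chain, and with
  \<open>g a z = p a y\<close> those that make up \<open>\<alpha>\<close>.
\<close>

lemma nn_integral_path_sum_before_hitting:
  assumes p: "transition_matrix p" and \<mu>: "distribution \<mu>" and g: "\<And>a z. 0 \<le> g a z"
    and sm: "\<And>a z. summable (\<lambda>n. taboo p y n a z)"
  shows "(\<integral>\<^sup>+\<omega>. (\<Sum>n. if enat (Suc n) \<le> hitting_time y \<omega> then ennreal (g (\<omega> 0) (\<omega> (Suc n))) else 0) \<partial>path_measure p \<mu>)
       = ennreal (\<Sum>a\<in>UNIV. \<Sum>z\<in>UNIV. \<mu> a * green p y a z * g a z)"
proof -
  have meas: "(\<lambda>\<omega>. if enat (Suc n) \<le> hitting_time y \<omega> then ennreal (g (\<omega> 0) (\<omega> (Suc n))) else 0)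
      \<in> borel_measurable (path_measure p \<mu>)" for n
    unfolding path_function_eq_sum_indicator
    by (intro borel_measurable_sum borel_measurable_before_hitting)
  have sums: "(\<lambda>n. \<Sum>a\<in>UNIV. \<Sum>z\<in>UNIV. \<mu> a * taboo p y n a z * g a z)
      sums (\<Sum>a\<in>UNIV. \<Sum>z\<in>UNIV. \<mu> a * green p y a z * g a z)"
    unfolding green_def by (intro sums_sum sums_mult2 sums_mult summable_sums sm)
  have nn: "0 \<le> (\<Sum>a\<in>UNIV. \<Sum>z\<in>UNIV. \<mu> a * taboo p y n a z * g a z)" for n
    using g \<mu> taboo_nonneg[OF p] by (simp add: sum_nonneg distribution_def)
  show ?thesis
    using suminf_ennreal2[OF nn sums_summable[OF sums]] sums_unique[OF sums]
    by (simp add: nn_integral_suminf meas nn_integral_path_before_hitting[where g = g, OF p \<mu> g])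
qed

lemma ennreal_of_enat_eq_suminf:
  "ennreal_of_enat N = (\<Sum>n. if enat (Suc n) \<le> N then 1 else 0)"
proof (cases N)
  case (enat k)
  have "(\<Sum>n. if enat (Suc n) \<le> N then 1 else 0 :: ennreal) = (\<Sum>n<k. if enat (Suc n) \<le> N then 1 else 0)"
    by (rule suminf_finite) (auto simp: enat)
  also have "\<dots> = (\<Sum>n<k. 1)" by (rule sum.cong) (auto simp: enat)
  finally show ?thesis by (simp add: enat)
next
  case infinity
  have "(\<Sum>n::nat. 1 :: ennreal) = (\<integral>\<^sup>+n. 1 \<partial>count_space (UNIV :: nat set))"
    by (simp only: nn_integral_count_space_nat)
  also have "\<dots> = emeasure (count_space (UNIV :: nat set)) UNIV"
    by simp
  also have "\<dots> = top" by (simp add: emeasure_count_space_infinite)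
  finally show ?thesis using infinity by simp
qed

section \<open>Convergence to equilibrium\<close>

text \<open>
  Since \<open>\<delta>\<close> has total mass \<open>0\<close>, the column \<open>c\<close> of \<open>r\<close> may be lowered by \<open>\<epsilon>\<close> without changing the
  image of \<open>\<delta>\<close>; the rows of the lowered matrix are nonnegative and have sum \<open>1 - \<epsilon>\<close>.
\<close>

lemma signed_mass_contraction:
  fixes r :: "'s::finite \<Rightarrow> 's \<Rightarrow> real"
  assumes \<delta>: "(\<Sum>s\<in>UNIV. \<delta> s) = 0" and row: "\<And>s. (\<Sum>t\<in>UNIV. r s t) = 1"
    and nn: "\<And>s t. 0 \<le> r s t" and \<epsilon>: "\<And>s. \<epsilon> \<le> r s c"
  shows "(\<Sum>t\<in>UNIV. \<bar>\<Sum>s\<in>UNIV. \<delta> s * r s t\<bar>) \<le> (1 - \<epsilon>) * (\<Sum>s\<in>UNIV. \<bar>\<delta> s\<bar>)"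
proof -
  let ?e = "\<lambda>t. if t = c then \<epsilon> else 0"
  have "\<bar>\<Sum>s\<in>UNIV. \<delta> s * r s t\<bar> \<le> (\<Sum>s\<in>UNIV. \<bar>\<delta> s\<bar> * (r s t - ?e t))" for t
  proof -
    have "(\<Sum>s\<in>UNIV. \<delta> s * r s t) = (\<Sum>s\<in>UNIV. \<delta> s * (r s t - ?e t))"
      using \<delta> by (simp add: right_diff_distrib sum_subtractf sum_distrib_right[symmetric])
    also have "\<bar>\<dots>\<bar> \<le> (\<Sum>s\<in>UNIV. \<bar>\<delta> s * (r s t - ?e t)\<bar>)" by (rule sum_abs)
    also have "\<dots> = (\<Sum>s\<in>UNIV. \<bar>\<delta> s\<bar> * (r s t - ?e t))"
      by (rule sum.cong[OF refl]) (use nn \<epsilon> in \<open>auto simp: abs_mult\<close>)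
    finally show ?thesis .
  qed
  then have "(\<Sum>t\<in>UNIV. \<bar>\<Sum>s\<in>UNIV. \<delta> s * r s t\<bar>) \<le> (\<Sum>t\<in>UNIV. \<Sum>s\<in>UNIV. \<bar>\<delta> s\<bar> * (r s t - ?e t))"
    by (rule sum_mono)
  also have "\<dots> = (\<Sum>s\<in>UNIV. \<bar>\<delta> s\<bar> * ((\<Sum>t\<in>UNIV. r s t) - (\<Sum>t\<in>UNIV. ?e t)))"
    by (subst sum.swap) (simp only: sum_distrib_left[symmetric] sum_subtractf)
  also have "\<dots> = (1 - \<epsilon>) * (\<Sum>s\<in>UNIV. \<bar>\<delta> s\<bar>)"
    by (simp add: row sum_distrib_right[symmetric] mult.commute)
  finally show ?thesis .
qed

text \<open>
  The distance in \<open>\<ell>\<^sup>1\<close> to equilibrium never increases and shrinks by a fixed factor in each block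
  of \<open>m\<close> steps.
\<close>

lemma doeblin_convergence:
  fixes q :: "'s::finite \<Rightarrow> 's \<Rightarrow> real"
  assumes q: "transition_matrix q" and pos: "\<And>s. 0 < n_step q m s c"
    and \<nu>: "invariant_distribution q \<nu>"
    and evol: "\<And>n t. \<mu> (Suc n) t = (\<Sum>s\<in>UNIV. \<mu> n s * q s t)"
    and mass: "\<And>n. (\<Sum>s\<in>UNIV. \<mu> n s) = 1"
  shows "(\<lambda>n. \<mu> n t) \<longlonglongrightarrow> \<nu> t"
proof -
  define \<delta> where "\<delta> n s = \<mu> n s - \<nu> s" for n s
  define D where "D n = (\<Sum>s\<in>UNIV. \<bar>\<delta> n s\<bar>)" for n
  define \<epsilon> where "\<epsilon> = (MIN s. n_step q m s c)"
  have \<epsilon>: "\<epsilon> \<le> n_step q m s c" for s unfolding \<epsilon>_def by simp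
  have "0 < \<epsilon>" unfolding \<epsilon>_def using pos by simp
  have "\<epsilon> \<le> 1"
    using \<epsilon>[of c] member_le_sum[of c UNIV "n_step q m c"] n_step_row_sum[OF q, of m c]
    by (simp add: n_step_nonneg[OF q])
  have \<delta>_evol: "\<delta> (Suc n) t = (\<Sum>s\<in>UNIV. \<delta> n s * q s t)" for n t
    using \<nu> by (simp add: \<delta>_def evol left_diff_distrib sum_subtractf invariant_distribution_def)
  have \<delta>0: "(\<Sum>s\<in>UNIV. \<delta> n s) = 0" for n
    using \<nu> mass by (simp add: \<delta>_def sum_subtractf invariant_distribution_def distribution_def)
  have D_nn: "0 \<le> D n" for n by (simp add: D_def sum_nonneg)
  have block: "D (n + m) \<le> (1 - \<epsilon>) * D n" for n
    unfolding D_def n_step_evolution[of \<delta>, OF \<delta>_evol]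
    by (rule signed_mass_contraction[OF \<delta>0 n_step_row_sum[OF q] n_step_nonneg[OF q] \<epsilon>])
  have "D (Suc n) \<le> (1 - 0) * D n" for n
    unfolding D_def \<delta>_evol
    by (rule signed_mass_contraction[OF \<delta>0]) (simp_all add: transition_matrixD[OF q])
  then have dec: "decseq D" by (simp add: decseq_Suc_iff)
  have geom: "D (k * m) \<le> (1 - \<epsilon>) ^ k * D 0" for k
  proof (induction k)
    case (Suc k)
    have "D (Suc k * m) \<le> (1 - \<epsilon>) * D (k * m)" using block[of "k * m"] by (simp add: add.commute)
    also have "\<dots> \<le> (1 - \<epsilon>) * ((1 - \<epsilon>) ^ k * D 0)"
      using Suc \<open>\<epsilon> \<le> 1\<close> by (intro mult_left_mono) auto
    finally show ?case by (simp add: mult.assoc)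
  qed simp
  have "(\<lambda>k. (1 - \<epsilon>) ^ k * D 0) \<longlonglongrightarrow> 0"
    using \<open>0 < \<epsilon>\<close> \<open>\<epsilon> \<le> 1\<close> by (intro tendsto_mult_left_zero LIMSEQ_power_zero) simp
  have "D \<longlonglongrightarrow> 0"
  proof (rule LIMSEQ_I)
    fix e :: real assume "0 < e"
    then obtain k where k: "(1 - \<epsilon>) ^ k * D 0 < e"
      using order_tendstoD(2)[OF \<open>(\<lambda>k. (1 - \<epsilon>) ^ k * D 0) \<longlonglongrightarrow> 0\<close>, of e]
      by (auto simp: eventually_sequentially)
    have "norm (D n - 0) < e" if "k * m \<le> n" for n
      using decseqD[OF dec that] geom[of k] k D_nn[of n] by simp
    then show "\<exists>n0. \<forall>n\<ge>n0. norm (D n - 0) < e" by blast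
  qed
  moreover have "\<bar>\<mu> n t - \<nu> t\<bar> \<le> D n" for n
    unfolding D_def \<delta>_def by (rule member_le_sum) auto
  ultimately have "(\<lambda>n. \<mu> n t - \<nu> t) \<longlonglongrightarrow> 0"
    using Lim_null_comparison[of "\<lambda>n. \<mu> n t - \<nu> t" D sequentially] by simp
  then show ?thesis by (simp add: LIM_zero_iff)
qed

section \<open>Aperiodicity\<close>

text \<open>
  Let \<open>d\<close> be the least positive difference of two elements, \<open>0\<close> being adjoined. Dividing any
  element by \<open>d\<close> with remainder exhibits the remainder as a difference, so \<open>d\<close> divides every
  element and \<open>d = 1\<close>. Two consecutive elements \<open>b\<close> and \<open>b + 1\<close> generate every
  \<open>n = q * b + r\<close> with \<open>r \<le> q\<close>, as \<open>(q - r) * b + r * (b + 1)\<close>.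
\<close>

lemma additive_set_Gcd_1_cofinite:
  fixes A :: "nat set"
  assumes add: "\<And>a b. a \<in> A \<Longrightarrow> b \<in> A \<Longrightarrow> a + b \<in> A" and gcd: "Gcd A = 1"
  shows "\<exists>n0. \<forall>n\<ge>n0. n \<in> A"
proof -
  let ?B = "insert 0 A"
  have B_add: "a + b \<in> ?B" if "a \<in> ?B" "b \<in> ?B" for a b using add that by auto
  have B_mult: "k * a \<in> ?B" if "a \<in> ?B" for k a
  proof (induction k)
    case (Suc k)
    then show ?case using B_add[OF that, of "k * a"] by (simp only: mult_Suc)
  qed simp
  define G where "G d \<longleftrightarrow> 0 < d \<and> (\<exists>b\<in>?B. b + d \<in> ?B)" for d
  obtain a where "a \<in> A" "a \<noteq> 0" using gcd by (metis Gcd_0_iff insertI1 subsetI zero_neq_one)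
  then have "G a" by (auto simp: G_def)
  define d where "d = (LEAST d. G d)"
  have "G d" unfolding d_def using \<open>G a\<close> by (rule LeastI)
  then obtain b where b: "b \<in> ?B" "b + d \<in> ?B" and "0 < d" unfolding G_def by blast
  have "d dvd c" if "c \<in> A" for c
  proof (rule ccontr)
    assume "\<not> d dvd c"
    then have "0 < c mod d" by (simp add: dvd_eq_mod_eq_0)
    have eq: "(c div d) * (b + d) + c mod d = c + (c div d) * b"
      by (simp add: algebra_simps)
    have "c + (c div d) * b \<in> ?B"
      by (rule B_add[OF insertI2[OF that] B_mult[OF b(1)]])
    then have "G (c mod d)"
      unfolding G_def
    proof (intro conjI bexI)
      show "(c div d) * (b + d) + c mod d \<in> ?B" unfolding eq by fact
    qed (use \<open>0 < c mod d\<close> B_mult[OF b(2)] in simp_all)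
    then show False
      using not_less_Least[of "c mod d" G] \<open>0 < d\<close> unfolding d_def[symmetric] by simp
  qed
  then have "d dvd Gcd A" by (rule Gcd_greatest)
  then have b': "b + 1 \<in> ?B" using b gcd by simp
  have "n \<in> A" if n: "b * b + 1 \<le> n" for n
  proof (cases "b = 0")
    case True
    then show ?thesis using B_mult[OF b', of n] n by simp
  next
    case False
    have "b * b < b + (n div b) * b"
      using dividend_less_div_times[of b n] n False by linarith
    then have "b * b < Suc (n div b) * b" by simp
    then have "b \<le> n div b" unfolding mult_less_cancel2 by simp
    then have "n mod b \<le> n div b"
      using mod_less_divisor[of b n] False by linarith
    then have "n = (n div b - n mod b) * b + (n mod b) * (b + 1)"
      using div_mult_mod_eq[of n b] mult_le_mono1[of "n mod b" "n div b" b]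
      by (simp add: algebra_simps diff_mult_distrib)
    moreover have "(n div b - n mod b) * b + (n mod b) * (b + 1) \<in> ?B"
      by (rule B_add[OF B_mult[OF b(1)] B_mult[OF b']])
    ultimately have "n \<in> ?B" by simp
    then show ?thesis using n by simp
  qed
  then show ?thesis by blast
qed

lemma aperiodic_eventually_pos:
  assumes p: "transition_matrix p" and "aperiodic_matrix p"
  shows "\<exists>n0. \<forall>n\<ge>n0. 0 < n_step p n x x"
proof -
  have "\<exists>n0. \<forall>n\<ge>n0. n \<in> {n. 0 < n \<and> 0 < n_step p n x x}"
    by (rule additive_set_Gcd_1_cofinite)
       (use assms in \<open>auto simp: aperiodic_matrix_def intro: n_step_pos_add\<close>)
  then show ?thesis by blast
qed

text \<open>
  From \<open>(y, y)\<close> both animals jump to the same \<open>w\<close> with probability \<open>p y w * p y w\<close>, so a path of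
  \<open>p\<close> lifts to the diagonal with its length unchanged. This is how aperiodicity passes to the pair.
\<close>

lemma cat_mouse_diagonal_pos:
  assumes p: "transition_matrix p"
  shows "0 < n_step p n y z \<Longrightarrow> 0 < n_step (cat_mouse_matrix p) n (y, y) (z, z)"
proof (induction n arbitrary: y)
  case (Suc n)
  obtain w where "0 < p y w" "0 < n_step p n w z"
    using iffD1[OF n_step_pos_Suc_iff[OF p] Suc.prems] by blast
  then show ?case
    unfolding n_step_pos_Suc_iff[OF transition_matrix_cat_mouse[OF p]]
    using Suc.IH by (intro exI[of _ "(w, w)"]) simp
qed (simp split: if_splits)

lemma cat_mouse_reaches_mouse:
  assumes p: "transition_matrix p"
  shows "0 < n_step p n x y \<Longrightarrow> \<exists>k. 0 < n_step (cat_mouse_matrix p) k (x, y) (y, y)"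
proof (induction n arbitrary: x)
  case 0
  then show ?case by (intro exI[of _ 0]) (simp split: if_splits)
next
  case (Suc n)
  show ?case
  proof (cases "x = y")
    case False
    obtain w where "0 < p x w" "0 < n_step p n w y"
      using iffD1[OF n_step_pos_Suc_iff[OF p] Suc.prems] by blast
    then obtain k where "0 < n_step (cat_mouse_matrix p) k (w, y) (y, y)" using Suc.IH by blast
    then have "0 < n_step (cat_mouse_matrix p) (Suc k) (x, y) (y, y)"
      unfolding n_step_pos_Suc_iff[OF transition_matrix_cat_mouse[OF p]]
      using False \<open>0 < p x w\<close> by (intro exI[of _ "(w, y)"]) simp
    then show ?thesis by blast
  qed (intro exI[of _ 0], simp)
qed

text \<open>
  Every state leads to \<open>(c, c)\<close> in some number of steps, and loops at \<open>(c, c)\<close> exist for all large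
  lengths; padding with such loops makes the number of steps the same for all starting states.
\<close>

lemma cat_mouse_doeblin:
  fixes p :: "'s::finite \<Rightarrow> 's \<Rightarrow> real"
  assumes p: "transition_matrix p" "irreducible_matrix p" "aperiodic_matrix p"
  shows "\<exists>m. \<forall>s. 0 < n_step (cat_mouse_matrix p) m s (c, c)"
proof -
  note q = transition_matrix_cat_mouse[OF p(1)]
  have "\<exists>k. 0 < n_step (cat_mouse_matrix p) k s (c, c)" for s
  proof (cases s)
    case (Pair x y)
    obtain i j where "0 < n_step p i x y" "0 < n_step p j y c"
      using p(2) unfolding irreducible_matrix_def by blast
    then show ?thesis
      using cat_mouse_reaches_mouse[OF p(1)] cat_mouse_diagonal_pos[OF p(1)] n_step_pos_add[OF q] Pair
      by metis
  qed
  then obtain k where k: "\<And>s. 0 < n_step (cat_mouse_matrix p) (k s) s (c, c)" by metis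
  obtain n0 where n0: "\<And>n. n0 \<le> n \<Longrightarrow> 0 < n_step p n c c"
    using aperiodic_eventually_pos[OF p(1,3)] by blast
  have "0 < n_step (cat_mouse_matrix p) ((MAX s. k s) + n0) s (c, c)" for s
  proof -
    have le: "k s \<le> (MAX s. k s)" by simp
    then have "0 < n_step (cat_mouse_matrix p) (k s + ((MAX s. k s) + n0 - k s)) s (c, c)"
      by (intro n_step_pos_add[OF q k] cat_mouse_diagonal_pos[OF p(1)] n0) (use le in linarith)
    then show ?thesis using le by simp
  qed
  then show ?thesis by blast
qed

section \<open>The invariant measure of the cat and mouse chain\<close>

text \<open>
  Positivity is what makes the division by \<open>\<pi> x\<close> in the reversed matrix meaningful.
\<close>

lemma invariant_distribution_pos:
  assumes p: "transition_matrix p" and "irreducible_matrix p" and inv: "invariant_distribution p \<pi>"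
  shows "0 < \<pi> y"
proof -
  have nn: "0 \<le> \<pi> x" for x using inv by (simp add: invariant_distribution_def distribution_def)
  have "\<exists>x. 0 < \<pi> x"
    using inv unfolding invariant_distribution_def distribution_def
    by (metis not_le sum_nonpos zero_less_one)
  then obtain x where x: "0 < \<pi> x" by blast
  obtain n where n: "0 < n_step p n x y" using assms(2) unfolding irreducible_matrix_def by blast
  have "\<pi> y = (\<Sum>x\<in>UNIV. \<pi> x * n_step p n x y)"
    by (rule n_step_evolution[of "\<lambda>_. \<pi>"]) (use inv in \<open>simp add: invariant_distribution_def\<close>)
  also have "\<dots> > 0"
    by (rule sum_pos2[of _ x]) (use x n nn n_step_nonneg[OF p] in auto)
  finally show ?thesis .
qed

definition cat_mouse_weight :: "('s::finite \<Rightarrow> 's \<Rightarrow> real) \<Rightarrow> ('s \<Rightarrow> real) \<Rightarrow> 's \<Rightarrow> 's \<Rightarrow> real" where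
  "cat_mouse_weight p \<pi> x y = (\<Sum>a\<in>UNIV. \<pi> a * p a y * green p y a x)"

lemma cat_mouse_weight_diagonal:
  assumes "transition_matrix p" "irreducible_matrix p" "invariant_distribution p \<pi>"
  shows "cat_mouse_weight p \<pi> y y = \<pi> y"
  using assms by (simp add: cat_mouse_weight_def green_taboo_state invariant_distribution_def)

lemma cat_mouse_weight_nonneg:
  assumes "transition_matrix p" "irreducible_matrix p" "invariant_distribution p \<pi>"
  shows "0 \<le> cat_mouse_weight p \<pi> x y"
  unfolding cat_mouse_weight_def using assms
  by (intro sum_nonneg mult_nonneg_nonneg green_nonneg)
     (auto simp: transition_matrixD invariant_distribution_def distribution_def)

text \<open>
  A transition into \<open>(x, y)\<close> comes from the diagonal, or is a step of the cat from \<open>(a, y)\<close> with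
  \<open>a \<noteq> y\<close>. As the diagonal carries \<open>\<pi>\<close>, the first contribution is the initial term of
  \<open>green_last_step\<close>, weighted by \<open>\<pi> b * p b y\<close>; the second is its sum over \<open>a \<noteq> y\<close>.
\<close>

lemma cat_mouse_weight_invariant:
  assumes p: "transition_matrix p" "irreducible_matrix p" and inv: "invariant_distribution p \<pi>"
  shows "(\<Sum>s\<in>UNIV. cat_mouse_weight p \<pi> (fst s) (snd s) * cat_mouse_matrix p s (x, y))
       = cat_mouse_weight p \<pi> x y"
proof -
  let ?w = "cat_mouse_weight p \<pi>"
  have "(\<Sum>s\<in>UNIV. ?w (fst s) (snd s) * cat_mouse_matrix p s (x, y))
      = (\<Sum>a\<in>UNIV. \<Sum>b\<in>UNIV. ?w a b * cat_mouse_matrix p (a, b) (x, y))"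
    by (simp add: sum.cartesian_product case_prod_beta flip: UNIV_Times_UNIV del: cat_mouse_matrix.simps)
  also have "\<dots> = (\<Sum>a\<in>UNIV. \<Sum>b\<in>UNIV. (if b = a then ?w a a * (p a x * p a y) else 0)
      + (if b = y then (if a \<in> -{y} then ?w a y * p a x else 0) else 0))"
    by (intro sum.cong refl) auto
  also have "\<dots> = (\<Sum>a\<in>UNIV. ?w a a * (p a x * p a y)) + (\<Sum>a\<in>-{y}. ?w a y * p a x)"
    by (simp add: sum.distrib sum.If_cases Compl_eq)
  also have "(\<Sum>a\<in>-{y}. ?w a y * p a x)
      = (\<Sum>b\<in>UNIV. \<pi> b * p b y * (\<Sum>a\<in>-{y}. green p y b a * p a x))"
    unfolding cat_mouse_weight_def sum_distrib_right sum_distrib_left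
    by (subst sum.swap) (simp add: mult.assoc)
  also have "(\<Sum>a\<in>UNIV. ?w a a * (p a x * p a y)) + \<dots> = ?w x y"
  proof -
    have "?w x y = (\<Sum>b\<in>UNIV. \<pi> b * p b y * (p b x + (\<Sum>a\<in>-{y}. green p y b a * p a x)))"
      unfolding cat_mouse_weight_def by (intro sum.cong refl arg_cong2[where f = times] green_last_step p)
    then show ?thesis
      unfolding cat_mouse_weight_diagonal[OF p inv] by (simp add: distrib_left sum.distrib mult_ac)
  qed
  finally show ?thesis .
qed

lemma nn_integral_reversed_path:
  assumes p: "transition_matrix p" "irreducible_matrix p" and inv: "invariant_distribution p \<pi>"
  shows "ennreal (\<pi> x) * (\<integral>\<^sup>+\<omega>. (\<Sum>n. if 1 \<le> n \<and> enat n \<le> hitting_time y \<omega> then ennreal (p (\<omega> n) y) else 0)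
          \<partial>path_measure (reversed_matrix p \<pi>) (point_mass x))
       = ennreal (cat_mouse_weight p \<pi> x y)"
proof -
  let ?r = "reversed_matrix p \<pi>"
  note pos = invariant_distribution_pos[OF p inv]
  have r: "transition_matrix ?r" by (rule transition_matrix_reversed[OF p(1) inv pos])
  have taboo: "taboo ?r y n a z = \<pi> z / \<pi> a * taboo p y n z a" for n a z
    using taboo_reversed[where p = p and y = y and n = n and x = a and z = z, OF pos] pos[of a] by (simp add: field_simps)
  have green: "green ?r y a z = \<pi> z / \<pi> a * green p y z a" for a z
    unfolding green_def taboo by (rule suminf_mult[OF summable_taboo[OF p]])
  have shift: "(\<Sum>n. if 1 \<le> n \<and> enat n \<le> hitting_time y \<omega> then ennreal (p (\<omega> n) y) else 0)
      = (\<Sum>n. if enat (Suc n) \<le> hitting_time y \<omega> then ennreal (p (\<omega> (Suc n)) y) else 0)" for \<omega>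
    using sums_Suc[OF summable_sums[OF summableI], of "\<lambda>n. if 1 \<le> n \<and> enat n \<le> hitting_time y \<omega> then ennreal (p (\<omega> n) y) else 0"]
    by (simp add: sums_iff)
  have "(\<integral>\<^sup>+\<omega>. (\<Sum>n. if 1 \<le> n \<and> enat n \<le> hitting_time y \<omega> then ennreal (p (\<omega> n) y) else 0)
          \<partial>path_measure ?r (point_mass x))
      = ennreal (\<Sum>a\<in>UNIV. \<Sum>z\<in>UNIV. point_mass x a * green ?r y a z * p z y)"
    unfolding shift
    by (rule nn_integral_path_sum_before_hitting[OF r distribution_point_mass])
       (simp_all add: transition_matrixD[OF p(1)] taboo summable_taboo[OF p] summable_mult)
  also have "(\<Sum>a\<in>UNIV. \<Sum>z\<in>UNIV. point_mass x a * green ?r y a z * p z y)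
      = (\<Sum>a\<in>UNIV. if a = x then \<Sum>z\<in>UNIV. green ?r y a z * p z y else 0)"
    by (rule sum.cong) (auto simp: point_mass_def)
  also have "\<dots> = cat_mouse_weight p \<pi> x y / \<pi> x"
    by (simp add: green cat_mouse_weight_def sum_divide_distrib mult_ac)
  finally show ?thesis
    using pos[of x] cat_mouse_weight_nonneg[OF p inv]
    by (simp add: ennreal_mult[symmetric])
qed

lemma nn_integral_weighted_hitting_time:
  assumes p: "transition_matrix p" "irreducible_matrix p" and inv: "invariant_distribution p \<pi>"
  shows "(\<integral>\<^sup>+\<omega>. ennreal (p (\<omega> 0) y) * ennreal_of_enat (hitting_time y \<omega>) \<partial>path_measure p \<pi>)
       = ennreal (\<Sum>x\<in>UNIV. cat_mouse_weight p \<pi> x y)"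
proof -
  have "ennreal (p (\<omega> 0) y) * ennreal_of_enat (hitting_time y \<omega>)
      = (\<Sum>n. if enat (Suc n) \<le> hitting_time y \<omega> then ennreal (p (\<omega> 0) y) else 0)" for \<omega>
    unfolding ennreal_of_enat_eq_suminf ennreal_suminf_cmult[symmetric]
    by (rule suminf_cong) simp
  then have "(\<integral>\<^sup>+\<omega>. ennreal (p (\<omega> 0) y) * ennreal_of_enat (hitting_time y \<omega>) \<partial>path_measure p \<pi>)
      = ennreal (\<Sum>a\<in>UNIV. \<Sum>z\<in>UNIV. \<pi> a * green p y a z * p a y)"
    using nn_integral_path_sum_before_hitting[OF p(1), of \<pi> "\<lambda>a z. p a y" y] inv
    by (simp add: invariant_distribution_def transition_matrixD[OF p(1)] summable_taboo[OF p])
  also have "(\<Sum>a\<in>UNIV. \<Sum>z\<in>UNIV. \<pi> a * green p y a z * p a y) = (\<Sum>x\<in>UNIV. cat_mouse_weight p \<pi> x y)"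
    unfolding cat_mouse_weight_def by (subst sum.swap) (simp add: mult_ac)
  finally show ?thesis .
qed

text \<open>
  The computation behind Kac's formula: for the stationary chain, the probability that the hitting
  time of \<open>y\<close> is at least \<open>n + 2\<close> is the probability of avoiding \<open>y\<close> at the times \<open>0, \<dots>, n\<close>, since
  the law at time \<open>1\<close> is again \<open>\<pi>\<close>.
\<close>

lemma stationary_taboo_mass_Suc:
  assumes inv: "invariant_distribution p \<pi>"
  shows "(\<Sum>x\<in>UNIV. \<pi> x * (\<Sum>z\<in>UNIV. taboo p y (Suc n) x z))
       = (\<Sum>x\<in>UNIV. \<pi> x * (\<Sum>z\<in>UNIV. taboo p y n x z)) - \<pi> y * (\<Sum>z\<in>UNIV. taboo p y n y z)"
proof -
  have "(\<Sum>x\<in>UNIV. \<pi> x * (\<Sum>z\<in>UNIV. taboo p y (Suc n) x z))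
      = (\<Sum>x\<in>UNIV. \<Sum>w\<in>-{y}. \<pi> x * p x w * (\<Sum>z\<in>UNIV. taboo p y n w z))"
    unfolding taboo_Suc_left
    by (subst sum.swap) (simp add: sum_distrib_left mult.assoc)
  also have "\<dots> = (\<Sum>w\<in>-{y}. (\<Sum>x\<in>UNIV. \<pi> x * p x w) * (\<Sum>z\<in>UNIV. taboo p y n w z))"
    by (subst sum.swap) (simp add: sum_distrib_right)
  finally show ?thesis
    using inv by (simp add: invariant_distribution_def sum_Compl_singleton)
qed

text \<open>
  Reversibility replaces the factor \<open>\<pi> a * p a y\<close> by \<open>\<pi> y * p y a\<close>, a first step away from \<open>y\<close>.
  The absence of a loop at \<open>y\<close> guarantees that this step does not return to \<open>y\<close>, so that it extends
  the avoiding path. What remains is \<open>\<pi> y\<close> times the probability that the return time to \<open>y\<close> is at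
  least \<open>n + 2\<close>, and the preceding lemma writes it as a difference of consecutive terms.
\<close>

lemma cat_mouse_weight_mass_reversible:
  assumes p: "transition_matrix p" "irreducible_matrix p" and inv: "invariant_distribution p \<pi>"
    and rev: "reversible_matrix p \<pi>" and loop: "p y y = 0"
  shows "(\<Sum>x\<in>UNIV. cat_mouse_weight p \<pi> x y) = 1 - \<pi> y"
proof -
  \<comment> \<open>\<open>A n\<close> is the probability, for the stationary chain, that the hitting time is at least \<open>n + 1\<close>.\<close>
  define A where "A n = (\<Sum>x\<in>UNIV. \<pi> x * (\<Sum>z\<in>UNIV. taboo p y n x z))" for n
  have step: "(\<Sum>a\<in>UNIV. \<pi> a * p a y * (\<Sum>x\<in>UNIV. taboo p y n a x)) = A (Suc n) - A (Suc (Suc n))" for n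
  proof -
    have "(\<Sum>a\<in>UNIV. \<pi> a * p a y * (\<Sum>x\<in>UNIV. taboo p y n a x))
        = (\<Sum>a\<in>-{y}. \<pi> y * p y a * (\<Sum>x\<in>UNIV. taboo p y n a x))"
      using rev loop by (simp add: sum_Compl_singleton reversible_matrix_def)
    also have "\<dots> = \<pi> y * (\<Sum>x\<in>UNIV. taboo p y (Suc n) y x)"
      unfolding taboo_Suc_left by (subst sum.swap) (simp add: sum_distrib_left mult.assoc)
    also have "\<dots> = A (Suc n) - A (Suc (Suc n))"
      unfolding A_def stationary_taboo_mass_Suc[OF inv, of y "Suc n"] by simp
    finally show ?thesis .
  qed
  have A1: "A (Suc 0) = 1 - \<pi> y"
    unfolding A_def stationary_taboo_mass_Suc[OF inv]
    using inv by (simp add: transition_matrixD[OF p(1)] invariant_distribution_def distribution_def)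
  have "A \<longlonglongrightarrow> (\<Sum>x\<in>UNIV. \<pi> x * 0)"
    unfolding A_def by (intro tendsto_intros taboo_mass_tendsto_0 p)
  then have "(\<lambda>n. A (Suc n)) \<longlonglongrightarrow> 0" by (intro LIMSEQ_Suc) simp
  from telescope_sums'[OF this]
  have "(\<lambda>n. \<Sum>a\<in>UNIV. \<pi> a * p a y * (\<Sum>x\<in>UNIV. taboo p y n a x)) sums (1 - \<pi> y)"
    by (simp add: step A1)
  moreover have "(\<lambda>n. \<Sum>a\<in>UNIV. \<pi> a * p a y * (\<Sum>x\<in>UNIV. taboo p y n a x))
      sums (\<Sum>a\<in>UNIV. \<pi> a * p a y * (\<Sum>x\<in>UNIV. green p y a x))"
    unfolding green_def by (intro sums_sum sums_mult summable_sums summable_taboo p)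
  ultimately have "(\<Sum>a\<in>UNIV. \<pi> a * p a y * (\<Sum>x\<in>UNIV. green p y a x)) = 1 - \<pi> y"
    using sums_unique2 by blast
  moreover have "(\<Sum>x\<in>UNIV. cat_mouse_weight p \<pi> x y) = (\<Sum>a\<in>UNIV. \<pi> a * p a y * (\<Sum>x\<in>UNIV. green p y a x))"
    unfolding cat_mouse_weight_def by (subst sum.swap) (simp add: sum_distrib_left)
  ultimately show ?thesis by simp
qed

section \<open>The limit law\<close>

lemma integral_finite_valued:
  fixes X :: "'a \<Rightarrow> 's::finite" and f :: "'s \<Rightarrow> real"
  assumes "prob_space M" and X: "X \<in> measurable M (count_space UNIV)"
  shows "(\<integral>\<omega>. f (X \<omega>) \<partial>M) = (\<Sum>s\<in>UNIV. f s * measure M {\<omega> \<in> space M. X \<omega> = s})"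
proof -
  interpret prob_space M by fact
  have sets: "{\<omega> \<in> space M. X \<omega> = s} \<in> sets M" for s using X by measurable
  have "(\<integral>\<omega>. f (X \<omega>) \<partial>M) = (\<integral>\<omega>. (\<Sum>s\<in>UNIV. f s * indicator {\<omega> \<in> space M. X \<omega> = s} \<omega>) \<partial>M)"
  proof (rule Bochner_Integration.integral_cong[OF refl])
    fix \<omega> assume "\<omega> \<in> space M"
    then have "(\<Sum>s\<in>UNIV. f s * indicator {\<omega> \<in> space M. X \<omega> = s} \<omega>) = (\<Sum>s\<in>UNIV. if s = X \<omega> then f s else 0)"
      by (intro sum.cong) auto
    then show "f (X \<omega>) = (\<Sum>s\<in>UNIV. f s * indicator {\<omega> \<in> space M. X \<omega> = s} \<omega>)" by simp
  qed
  also have "\<dots> = (\<Sum>s\<in>UNIV. \<integral>\<omega>. f s * indicator {\<omega> \<in> space M. X \<omega> = s} \<omega> \<partial>M)"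
    by (intro Bochner_Integration.integral_sum integrable_mult_right integrable_real_indicator sets)
       (simp add: emeasure_eq_measure)
  also have "\<dots> = (\<Sum>s\<in>UNIV. f s * measure M {\<omega> \<in> space M. X \<omega> = s})"
    using sets by simp
  finally show ?thesis .
qed

lemma converges_in_distribution_finite:
  fixes X :: "nat \<Rightarrow> 'a \<Rightarrow> 's::finite"
  assumes "prob_space M" "\<And>n. X n \<in> measurable M (count_space UNIV)"
    and "prob_space L" "Y \<in> measurable L (count_space UNIV)"
    and lim: "\<And>s. (\<lambda>n. measure M {\<omega> \<in> space M. X n \<omega> = s}) \<longlonglongrightarrow> measure L {\<omega> \<in> space L. Y \<omega> = s}"
  shows "converges_in_distribution T M X L Y"
  unfolding converges_in_distribution_def
    integral_finite_valued[OF assms(1,2)] integral_finite_valued[OF assms(3,4)]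
  by (intro allI impI tendsto_intros lim)

lemma cat_mouse_convergence:
  fixes p :: "'s::finite \<Rightarrow> 's \<Rightarrow> real"
  assumes p: "transition_matrix p" "irreducible_matrix p" "aperiodic_matrix p"
    and inv: "invariant_distribution (cat_mouse_matrix p) \<nu>"
    and mc: "markov_chain M X (cat_mouse_matrix p)"
  shows "(\<lambda>n. measure M {\<omega> \<in> space M. X n \<omega> = s}) \<longlonglongrightarrow> \<nu> s"
proof -
  interpret prob_space M using mc by (simp add: markov_chain_def)
  have X: "X n \<in> measurable M (count_space UNIV)" for n using mc by (simp add: markov_chain_def)
  obtain m where m: "\<And>s. 0 < n_step (cat_mouse_matrix p) m s (undefined, undefined)"
    using cat_mouse_doeblin[OF p] by blast
  have mass: "(\<Sum>s\<in>UNIV. measure M {\<omega> \<in> space M. X n \<omega> = s}) = 1" for n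
    using integral_finite_valued[OF prob_space_axioms X, of "\<lambda>_. 1" n] by (simp add: prob_space)
  show ?thesis
    by (rule doeblin_convergence[where \<mu> = "\<lambda>n s. measure M {\<omega> \<in> space M. X n \<omega> = s}",
          OF transition_matrix_cat_mouse[OF p(1)] m inv markov_chain_law_step[OF mc] mass])
qed

theorem corollary1:
  fixes p :: "'s::finite \<Rightarrow> 's \<Rightarrow> real"
    and \<pi> :: "'s \<Rightarrow> real"
    and M :: "'a measure"
    and C Mo :: "nat \<Rightarrow> 'a \<Rightarrow> 's"
    and \<alpha> :: ennreal
    and N :: nat
  defines "N \<equiv> CARD('s)"
    and "\<alpha> \<equiv> (\<Sum>y\<in>UNIV. \<integral>\<^sup>+\<omega>. ennreal (p (\<omega> 0) y) * ennreal_of_enat (hitting_time y \<omega>) \<partial>path_measure p \<pi>)"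
  assumes "transition_matrix p" "irreducible_matrix p" "aperiodic_matrix p"
    and "\<And>x. p x x = 0"
    and "invariant_distribution p \<pi>"
    and "markov_chain M (\<lambda>n \<omega>. (C n \<omega>, Mo n \<omega>)) (cat_mouse_matrix p)"
  shows "\<exists>(L :: ('s \<times> 's) measure) Cinf Minf.
    prob_space L \<and>
    Cinf \<in> measurable L (count_space UNIV) \<and> Minf \<in> measurable L (count_space UNIV) \<and>
    converges_in_distribution (discrete_topology UNIV)
      M (\<lambda>n \<omega>. (C n \<omega>, Mo n \<omega>)) L (\<lambda>\<omega>. (Cinf \<omega>, Minf \<omega>)) \<and>
    (\<forall>x y. ennreal \<P>(\<omega> in L. Cinf \<omega> = x \<and> Minf \<omega> = y) =
       inverse \<alpha> * ennreal (\<pi> x) *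
       (\<integral>\<^sup>+\<omega>. (\<Sum>n. if 1 \<le> n \<and> enat n \<le> hitting_time y \<omega> then ennreal (p (\<omega> n) y) else 0)
          \<partial>path_measure (reversed_matrix p \<pi>) (point_mass x))) \<and>
    (\<forall>x. ennreal \<P>(\<omega> in L. Cinf \<omega> = x \<and> Minf \<omega> = x) = inverse \<alpha> * ennreal (\<pi> x)) \<and>
    (reversible_matrix p \<pi> \<longrightarrow>
       (\<forall>y. \<P>(\<omega> in L. Minf \<omega> = y) = (1 - \<pi> y) / (real N - 1)))"
proof -
  note p = assms(3,4) and aper = assms(5) and loop = assms(6) and inv = assms(7) and mc = assms(8)
  let ?w = "cat_mouse_weight p \<pi>"
  note pos = invariant_distribution_pos[OF p inv]
  note w_nn = cat_mouse_weight_nonneg[OF p inv]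
  have \<pi>1: "(\<Sum>x\<in>UNIV. \<pi> x) = 1"
    using inv by (simp add: invariant_distribution_def distribution_def)
  define a where "a = (\<Sum>y\<in>UNIV. \<Sum>x\<in>UNIV. ?w x y)"
  have \<alpha>: "\<alpha> = ennreal a"
    unfolding assms(2) a_def nn_integral_weighted_hitting_time[OF p inv]
    by (rule sum_ennreal) (simp add: sum_nonneg w_nn)
  \<comment> \<open>The diagonal alone has weight \<open>1\<close>, so the total weight may be divided by.\<close>
  have "(\<Sum>y\<in>UNIV. ?w y y) \<le> a"
    unfolding a_def by (intro sum_mono member_le_sum) (auto simp: w_nn)
  then have "1 \<le> a" using \<pi>1 by (simp add: cat_mouse_weight_diagonal[OF p inv])
  define \<nu> where "\<nu> s = ?w (fst s) (snd s) / a" for s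
  have "(\<Sum>s\<in>UNIV. ?w (fst s) (snd s)) = a"
    unfolding a_def by (subst sum.swap) (simp add: sum.cartesian_product case_prod_beta flip: UNIV_Times_UNIV)
  then have \<nu>: "distribution \<nu>"
    using \<open>1 \<le> a\<close> w_nn by (simp add: \<nu>_def distribution_def sum_divide_distrib[symmetric])
  have "(\<Sum>s\<in>UNIV. \<nu> s * cat_mouse_matrix p s t) = \<nu> t" for t
    using cat_mouse_weight_invariant[OF p inv, of "fst t" "snd t"]
    by (simp add: \<nu>_def sum_divide_distrib[symmetric])
  then have \<nu>_inv: "invariant_distribution (cat_mouse_matrix p) \<nu>"
    using \<nu> by (simp add: invariant_distribution_def)
  define L where "L = measure_pmf (embed_pmf \<nu>)"
  have L: "prob_space L" and L_meas: "f \<in> measurable L (count_space UNIV)" for f :: "'s \<times> 's \<Rightarrow> 'b"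
    by (simp_all add: L_def measure_pmf.prob_space_axioms)
  have L_pt: "\<P>(\<omega> in L. fst \<omega> = x \<and> snd \<omega> = y) = ?w x y / a" for x y
  proof -
    have "{\<omega>. fst \<omega> = x \<and> snd \<omega> = y} = {(x, y)}" by auto
    then show ?thesis
      by (simp add: L_def measure_pmf_single pmf_embed_distribution[OF \<nu>] \<nu>_def)
  qed
  have scale: "ennreal (?w x y / a) = inverse \<alpha> * ennreal (?w x y)" for x y
    using \<open>1 \<le> a\<close> by (simp add: \<alpha> divide_inverse inverse_ennreal ennreal_mult w_nn mult.commute)
  have conv: "converges_in_distribution (discrete_topology UNIV)
      M (\<lambda>n \<omega>. (C n \<omega>, Mo n \<omega>)) L (\<lambda>\<omega>. (fst \<omega>, snd \<omega>))"
  proof (rule converges_in_distribution_finite[OF _ _ L L_meas])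
    fix s
    have "measure L {\<omega> \<in> space L. (fst \<omega>, snd \<omega>) = s} = \<nu> s"
      by (simp add: L_def measure_pmf_single pmf_embed_distribution[OF \<nu>])
    then show "(\<lambda>n. measure M {\<omega> \<in> space M. (C n \<omega>, Mo n \<omega>) = s})
        \<longlonglongrightarrow> measure L {\<omega> \<in> space L. (fst \<omega>, snd \<omega>) = s}"
      using cat_mouse_convergence[OF p aper \<nu>_inv mc, of s] by (simp only:)
  qed (use mc in \<open>simp_all add: markov_chain_def\<close>)
  have marginal: "\<P>(\<omega> in L. snd \<omega> = y) = (1 - \<pi> y) / (real N - 1)" if rev: "reversible_matrix p \<pi>" for y
  proof -
    have col: "(\<Sum>x\<in>UNIV. ?w x y) = 1 - \<pi> y" for y
      by (rule cat_mouse_weight_mass_reversible[OF p inv rev loop])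
    have "a = real N - 1"
      unfolding a_def col assms(1) by (simp add: sum_subtractf \<pi>1)
    moreover have "\<P>(\<omega> in L. snd \<omega> = y) = (\<Sum>x\<in>UNIV. \<P>(\<omega> in L. snd \<omega> = y \<and> fst \<omega> = x))"
      using measure_split_value[OF L L_meas, of "\<lambda>\<omega>. snd \<omega> = y" fst UNIV] by (simp add: L_def)
    ultimately show ?thesis
      using L_pt col by (simp add: conj_commute sum_divide_distrib[symmetric])
  qed
  show ?thesis
  proof (rule exI[of _ L], rule exI[of _ fst], rule exI[of _ snd], intro conjI allI impI L L_meas conv marginal)
    fix x y
    show "ennreal \<P>(\<omega> in L. fst \<omega> = x \<and> snd \<omega> = y) = inverse \<alpha> * ennreal (\<pi> x) *
       (\<integral>\<^sup>+\<omega>. (\<Sum>n. if 1 \<le> n \<and> enat n \<le> hitting_time y \<omega> then ennreal (p (\<omega> n) y) else 0)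
          \<partial>path_measure (reversed_matrix p \<pi>) (point_mass x))"
      unfolding L_pt scale mult.assoc nn_integral_reversed_path[OF p inv] ..
    show "ennreal \<P>(\<omega> in L. fst \<omega> = x \<and> snd \<omega> = x) = inverse \<alpha> * ennreal (\<pi> x)"
      using scale[of x x] unfolding L_pt cat_mouse_weight_diagonal[OF p inv] .
  qed
qed

end
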